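(* There exist a probability measure $\sigma$ on $\mathbb{T}$ with infinite support belonging to the Szeg\H{o} class and a sequence $\{\alpha_n\}_{n\in\mathbb{Z}^+}\in\ell^2(\mathbb{Z}^+)$ such that the series $\sum_{n\in\mathbb{Z}^+}\alpha_n\phi_n(z,\sigma)$ diverges at every $z\in\mathbb{T}$.
   Context: $\mathbb{T}$ is the unit circle, $\mathbb{Z}^+=\{0,1,2,\dots\}$, and $m$ the normalized Lebesgue (probability) measure on $\mathbb{T}$. For a probability measure $\sigma$ on $\mathbb{T}$ with infinite support, $\phi_n(z,\sigma)$ denotes the orthonormal polynomials: $\deg\phi_n=n$, positive leading coefficient, $\int_{\mathbb{T}}\phi_n\overline{\phi_k}\,d\sigma=\delta_{nk}$. The measure $\sigma$ is in the Szeg\H{o} class if, writing $d\sigma=w\,dm+d\sigma_s$ with $\sigma_s$ singular, $\int_{\mathbb{T}}\log w\,dm>-\infty$. *)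

theory Defs
  imports "HOL-Probability.Probability" "HOL-Computational_Algebra.Polynomial"
begin

definition circleT :: "complex set" where
  "circleT = sphere 0 1"

definition circle_lebesgue :: "complex measure" where
  "circle_lebesgue =
     distr (density lborel (\<lambda>t::real. ennreal (indicator {0..2*pi} t / (2*pi))))
           borel (\<lambda>t. cis t)"

definition prob_measure_on_T :: "complex measure \<Rightarrow> bool" where
  "prob_measure_on_T \<sigma> \<longleftrightarrow>
     sets \<sigma> = sets borel \<and> prob_space \<sigma> \<and> emeasure \<sigma> (UNIV - circleT) = 0"

definition measure_support :: "complex measure \<Rightarrow> complex set" where
  "measure_support \<sigma> = {z. \<forall>e>0. emeasure \<sigma> (ball z e) > 0}"

text \<open>Szego class: d sigma = w dm + d sigma_s with sigma_s singular w.r.t. m and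
  \<integral> log w dm > -\<infinity>.  Since w \<in> L^1(m), log^+ w is integrable, so the last
  condition means: w > 0 m-a.e. and log w is m-integrable.\<close>
definition szego_class :: "complex measure \<Rightarrow> bool" where
  "szego_class \<sigma> \<longleftrightarrow>
     (\<exists>(w :: complex \<Rightarrow> real) (\<sigma>s :: complex measure) (N :: complex set).
        w \<in> borel_measurable borel \<and> (\<forall>z. w z \<ge> 0) \<and>
        sets \<sigma>s = sets borel \<and>
        N \<in> sets borel \<and> emeasure circle_lebesgue N = 0 \<and> emeasure \<sigma>s (UNIV - N) = 0 \<and>
        (\<forall>A \<in> sets borel. emeasure \<sigma> A =
            emeasure (density circle_lebesgue (\<lambda>z. ennreal (w z))) A + emeasure \<sigma>s A) \<and>
        (AE z in circle_lebesgue. w z > 0) \<and>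
        integrable circle_lebesgue (\<lambda>z. ln (w z)))"

definition orthonormal_polys :: "complex measure \<Rightarrow> (nat \<Rightarrow> complex poly) \<Rightarrow> bool" where
  "orthonormal_polys \<sigma> \<phi> \<longleftrightarrow>
     (\<forall>n. degree (\<phi> n) = n \<and> Im (lead_coeff (\<phi> n)) = 0 \<and> Re (lead_coeff (\<phi> n)) > 0) \<and>
     (\<forall>n k. integral\<^sup>L \<sigma> (\<lambda>z. poly (\<phi> n) z * cnj (poly (\<phi> k) z)) =
              (if n = k then 1 else 0))"

end

theory Submission
  imports Defs "HOL-Complex_Analysis.Complex_Analysis"
begin

text \<open>
  Let \<open>\<Phi>\<^sub>n\<close> be the monic orthogonal polynomials with recursion parameters \<open>b\<^sub>n\<close> and \<open>\<Psi>\<^sub>n\<close> their reversals. On the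
  circle \<open>z b\<^sub>n \<Phi>\<^sub>n = \<Psi>\<^sub>n\<^sub>+\<^sub>1 - \<Psi>\<^sub>n\<close>, so the series with \<open>\<alpha>\<^sub>n = b\<^sub>n \<parallel>\<Phi>\<^sub>n\<parallel>\<close> has partial sums
  \<open>(\<Psi>\<^sub>N - 1) / z\<close>. It suffices to find square summable \<open>b\<close> such that \<open>\<Psi>\<^sub>n(z)\<close> diverges at every \<open>z\<close>, while along
  a subsequence \<open>|\<Psi>\<^sub>n|\<close> converges with uniform upper and lower bounds; the limit of \<open>1 / |\<Psi>\<^sub>n|\<^sup>2\<close> along that
  subsequence is then, up to normalisation, the density of the measure.

  On the circle \<open>u\<^sub>n = \<Psi>\<^sub>n(z)\<close> satisfies \<open>u\<^sub>n\<^sub>+\<^sub>1 = u\<^sub>n + b\<^sub>n z\<^sup>n\<^sup>+\<^sup>1 cnj u\<^sub>n\<close>. To second order, a block of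
  coefficients whose partial sums \<open>\<Sum> b\<^sub>n z\<^sup>n\<^sup>+\<^sup>1\<close> trace out a closed planar loop multiplies \<open>u\<close> by a phase, the
  enclosed area. For a chirp with \<open>\<ell>\<^sup>2\<close> norm \<open>\<epsilon>\<close> the areas add up to \<open>\<epsilon>\<^sup>2 ln T\<close> before resonance (a harmonic sum),
  which exceeds 1 for large \<open>T\<close>, whereas \<open>|u|\<close> changes by a factor \<open>1 + O(\<epsilon>)\<close> only. Concatenating such stages
  with \<open>\<epsilon> = O(2\<^sup>-\<^sup>k)\<close>, each rotated so as to act on a different arc, gives \<open>b\<close>.
\<close>

subsection \<open>Recursions with conjugation\<close>

lemma sum_by_parts:
  fixes F g :: "nat \<Rightarrow> 'a::comm_ring"
  shows "(\<Sum>i<n. (F (Suc i) - F i) * g i) = F n * g n - F 0 * g 0 - (\<Sum>i<n. F (Suc i) * (g (Suc i) - g i))"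
  by (induction n) (auto simp: algebra_simps)

text \<open>A discrete Gronwall inequality: relative increments \<open>\<gamma> i\<close> compound
  to at most the product of the \<open>1 + \<gamma> i\<close>, and \<open>1 + x\<close> is at most
  \<open>exp x\<close>. Controlling the displacement instead of the norm shows that a small total
  keeps the orbit near its start.\<close>

lemma norm_diff_le_exp_sum:
  fixes W :: "nat \<Rightarrow> 'a::real_normed_vector"
  assumes "\<And>i. i < n \<Longrightarrow> norm (W (Suc i) - W i) \<le> \<gamma> i * norm (W i)"
    and "\<And>i. i < n \<Longrightarrow> 0 \<le> \<gamma> i"
  shows "norm (W n - W 0) \<le> (exp (\<Sum>i<n. \<gamma> i) - 1) * norm (W 0)"
  using assms
proof (induction n)
  case (Suc n)
  define E where "E = exp (\<Sum>i<n. \<gamma> i)"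
  have IH: "norm (W n - W 0) \<le> (E - 1) * norm (W 0)" unfolding E_def using Suc by simp
  have "norm (W n) \<le> norm (W n - W 0) + norm (W 0)"
    by (metis diff_add_cancel norm_triangle_ineq)
  then have Wn: "norm (W n) \<le> E * norm (W 0)" using IH by (simp add: algebra_simps)
  have g: "0 \<le> \<gamma> n" using Suc.prems by simp
  have "norm (W (Suc n) - W 0) \<le> norm (W (Suc n) - W n) + norm (W n - W 0)"
    by (metis diff_add_cancel add_diff_eq norm_triangle_ineq)
  also have "\<dots> \<le> \<gamma> n * (E * norm (W 0)) + (E - 1) * norm (W 0)"
    using Suc.prems(1)[of n] IH mult_left_mono[OF Wn g] by simp
  also have "\<dots> = (E * (1 + \<gamma> n) - 1) * norm (W 0)" by (simp add: algebra_simps)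
  also have "\<dots> \<le> (E * exp (\<gamma> n) - 1) * norm (W 0)"
    by (intro mult_right_mono diff_right_mono mult_left_mono exp_ge_add_one_self) (auto simp: E_def)
  finally show ?case by (simp add: E_def exp_add)
qed simp

text \<open>Picard iteration carried to second order. The \<open>f i\<close> are bounded only in
  total variation, but their partial sums \<open>F\<close> are at most \<rho>, so each summation by
  parts gains a factor \<rho>; the third-order remainder gains two.\<close>

lemma conj_recursion_expansion:
  fixes u f :: "nat \<Rightarrow> complex" and \<rho> :: real and T :: nat
  defines "F \<equiv> \<lambda>j. \<Sum>i<j. f i"
  assumes rec: "\<And>j. j < T \<Longrightarrow> u (Suc j) = u j + f j * cnj (u j)"
    and \<rho>: "\<And>j. j \<le> T \<Longrightarrow> cmod (F j) \<le> \<rho>" and "\<rho> \<le> 1"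
    and s: "(\<Sum>i<T. cmod (f i)) \<le> 1"
  shows "\<And>j. j \<le> T \<Longrightarrow> cmod (u j) \<le> 3 * cmod (u 0)"
    and "cmod (u T - u 0 - F T * cnj (u 0) - (\<Sum>j<T. f j * cnj (F j)) * u 0) \<le> 15 * \<rho>\<^sup>2 * cmod (u 0)"
proof -
  have \<rho>0: "0 \<le> \<rho>" using \<rho>[of 0] by (meson norm_ge_zero order_trans zero_le)
  have s': "(\<Sum>i<j. cmod (f i)) \<le> 1" if "j \<le> T" for j
    using s sum_mono2[of "{..<T}" "{..<j}" "\<lambda>i. cmod (f i)"] that by fastforce
  show ub: "cmod (u j) \<le> 3 * cmod (u 0)" if "j \<le> T" for j
  proof -
    have "cmod (u j - u 0) \<le> (exp (\<Sum>i<j. cmod (f i)) - 1) * cmod (u 0)"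
      by (rule norm_diff_le_exp_sum) (use rec that in \<open>auto simp: norm_mult\<close>)
    also have "\<dots> \<le> (exp 1 - 1) * cmod (u 0)"
      using s'[OF that] by (intro mult_right_mono) auto
    also have "\<dots> \<le> 2 * cmod (u 0)"
      using exp_le by (intro mult_right_mono) auto
    finally show ?thesis
      using norm_triangle_ineq[of "u j - u 0" "u 0"] by simp
  qed
  have FS: "F (Suc i) - F i = f i" for i by (simp add: F_def)
  have F0: "F 0 = 0" by (simp add: F_def)
  have parts: "(\<Sum>i<j. f i * g i) = F j * g j - (\<Sum>i<j. F (Suc i) * (g (Suc i) - g i))" for g j
    using sum_by_parts[of F g j] by (simp add: FS F0)
  \<comment> \<open>Summation by parts trades \<open>f\<close> for its small partial sums. The
    cofactor \<open>g\<close> only has to vary at rate \<open>c\<close> relative to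
    \<open>cmod (f i)\<close>, whose total is at most 1.\<close>
  have bound: "cmod (\<Sum>i<j. f i * g i) \<le> \<rho> * (cmod (g j) + c)"
    if "j \<le> T" "\<And>i. i < j \<Longrightarrow> cmod (g (Suc i) - g i) \<le> cmod (f i) * c" "0 \<le> c" for g j c
  proof -
    have "cmod (\<Sum>i<j. F (Suc i) * (g (Suc i) - g i)) \<le> (\<Sum>i<j. \<rho> * (cmod (f i) * c))"
      by (rule sum_norm_le) (use that \<rho> \<rho>0 in \<open>auto simp: norm_mult intro!: mult_mono\<close>)
    also have "\<dots> = \<rho> * ((\<Sum>i<j. cmod (f i)) * c)" by (simp add: sum_distrib_left sum_distrib_right)
    also have "\<dots> \<le> \<rho> * (1 * c)"
      using s'[OF that(1)] that(3) \<rho>0 by (intro mult_left_mono mult_right_mono) auto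
    finally have 1: "cmod (\<Sum>i<j. F (Suc i) * (g (Suc i) - g i)) \<le> \<rho> * c" by simp
    have 2: "cmod (F j * g j) \<le> \<rho> * cmod (g j)"
      using \<rho>[OF that(1)] by (simp add: norm_mult mult_right_mono)
    show ?thesis unfolding parts
      using 1 2 norm_triangle_ineq4[of "F j * g j" "\<Sum>i<j. F (Suc i) * (g (Suc i) - g i)"]
      by (simp add: algebra_simps)
  qed
  define K where "K = cmod (u 0)"
  have K0: "0 \<le> K" by (simp add: K_def)
  define d where "d = (\<lambda>j. u j - u 0)"
  have d: "d j = (\<Sum>i<j. f i * cnj (u i))" if "j \<le> T" for j
    using that by (induction j) (auto simp: d_def rec algebra_simps)
  have ub': "cmod (u j) \<le> 3 * K" if "j \<le> T" for j using ub[OF that] by (simp add: K_def)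
  have db: "cmod (d j) \<le> 6 * \<rho> * K" if "j \<le> T" for j
  proof -
    have "cmod (d j) \<le> \<rho> * (cmod (cnj (u j)) + 3 * K)"
      unfolding d[OF that]
      by (rule bound) (use that ub' K0 rec in \<open>auto simp: norm_mult intro!: mult_left_mono\<close>)
    also have "\<dots> \<le> \<rho> * (3 * K + 3 * K)"
      using ub'[OF that] \<rho>0 by (intro mult_left_mono add_mono) auto
    finally show ?thesis by simp
  qed
  define e where "e = (\<lambda>j. \<Sum>i<j. f i * cnj (d i))"
  have eb: "cmod (e j) \<le> 9 * \<rho> * K" if "j \<le> T" for j
  proof -
    have "cmod (e j) \<le> \<rho> * (cmod (cnj (d j)) + 3 * K)"
      unfolding e_def
    proof (rule bound)
      fix i assume "i < j"
      then show "cmod (cnj (d (Suc i)) - cnj (d i)) \<le> cmod (f i) * (3 * K)"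
        using that ub'[of i] rec[of i] by (auto simp: d_def norm_mult intro!: mult_left_mono)
    qed (use that K0 in auto)
    also have "\<dots> \<le> \<rho> * (6 * 1 * K + 3 * K)"
    proof -
      have "cmod (d j) \<le> 6 * 1 * K"
        using db[OF that] \<open>\<rho> \<le> 1\<close> K0 by (meson mult_left_mono mult_right_mono order_trans zero_le_numeral)
      then show ?thesis using \<rho>0 by (intro mult_left_mono add_mono) auto
    qed
    finally show ?thesis by simp
  qed
  have de: "d j = F j * cnj (u 0) + e j" if "j \<le> T" for j
  proof -
    have "d j = (\<Sum>i<j. f i * cnj (u 0) + f i * cnj (d i))"
      unfolding d[OF that] by (rule sum.cong) (auto simp: d_def algebra_simps)
    then show ?thesis by (simp add: sum.distrib e_def F_def sum_distrib_right)
  qed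
  \<comment> \<open>Conjugating \<open>F j * cnj (u 0)\<close> inside the sum gives
    \<open>cnj (F j) * u 0\<close>. So the second-order term is complex linear in \<open>u 0\<close>
    and can act as a phase, while the first-order term is conjugate linear.\<close>
  have "e T = (\<Sum>j<T. f j * cnj (F j)) * u 0 + (\<Sum>j<T. f j * cnj (e j))"
    unfolding e_def[THEN fun_cong, of T] sum_distrib_right sum.distrib[symmetric]
    by (rule sum.cong) (auto simp: de algebra_simps)
  then have "u T - u 0 - F T * cnj (u 0) - (\<Sum>j<T. f j * cnj (F j)) * u 0 = (\<Sum>j<T. f j * cnj (e j))"
    using de[of T] by (simp add: d_def algebra_simps)
  moreover have "cmod (\<Sum>j<T. f j * cnj (e j)) \<le> \<rho> * (cmod (cnj (e T)) + 6 * \<rho> * K)"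
  proof (rule bound)
    fix i assume i: "i < T"
    have "cnj (e (Suc i)) - cnj (e i) = cnj (f i * cnj (d i))" by (simp add: e_def)
    then have "cmod (cnj (e (Suc i)) - cnj (e i)) = cmod (f i) * cmod (d i)"
      by (simp only: complex_mod_cnj norm_mult)
    then show "cmod (cnj (e (Suc i)) - cnj (e i)) \<le> cmod (f i) * (6 * \<rho> * K)"
      using db[of i] i by (auto intro!: mult_left_mono)
  qed (use K0 \<rho>0 in auto)
  moreover have "\<rho> * (cmod (cnj (e T)) + 6 * \<rho> * K) \<le> \<rho> * (9 * \<rho> * K + 6 * \<rho> * K)"
    using eb[of T] \<rho>0 by (intro mult_left_mono add_mono) auto
  ultimately show "cmod (u T - u 0 - F T * cnj (u 0) - (\<Sum>j<T. f j * cnj (F j)) * u 0) \<le> 15 * \<rho>\<^sup>2 * cmod (u 0)"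
    by (simp add: K_def power2_eq_square algebra_simps)
qed

text \<open>The rotating frame \<open>cis (- M k) * U k\<close> removes the angles. Each step then
  leaves the given error \<open>g r\<close> plus the quadratic discrepancy between
  \<open>cis (m r)\<close> and \<open>1 + \<i> * m r\<close>, and the discrete Gronwall bound
  applies.\<close>

lemma rotation_recursion:
  fixes U :: "nat \<Rightarrow> complex" and m g :: "nat \<Rightarrow> real"
  assumes "\<And>r. r < n \<Longrightarrow> cmod (U (Suc r) - U r - \<i> * of_real (m r) * U r) \<le> g r * cmod (U r)"
    and "\<And>r. r < n \<Longrightarrow> 0 \<le> g r"
  shows "cmod (U n - cis (\<Sum>r<n. m r) * U 0) \<le> (exp (\<Sum>r<n. g r + (m r)\<^sup>2) - 1) * cmod (U 0)"
proof -
  define M where "M = (\<lambda>k. \<Sum>r<k. m r)"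
  define W where "W = (\<lambda>k. cis (- M k) * U k)"
  have cisb: "cmod (cis x - 1 - \<i> * of_real x) \<le> x\<^sup>2" for x :: real
  proof -
    have "cmod (iexp x - (\<Sum>k\<le>1. (\<i> * x) ^ k / fact k)) \<le> \<bar>x\<bar> ^ Suc 1 / fact (Suc 1)"
      by (rule iexp_approx1)
    then have "cmod (cis x - 1 - \<i> * of_real x) \<le> x\<^sup>2 / 2"
      by (simp add: cis_conv_exp power2_eq_square algebra_simps)
    also have "\<dots> \<le> x\<^sup>2" by simp
    finally show ?thesis .
  qed
  have step: "cmod (W (Suc r) - W r) \<le> (g r + (m r)\<^sup>2) * cmod (W r)" if "r < n" for r
  proof -
    have "W (Suc r) - W r = cis (- M (Suc r)) * ((U (Suc r) - U r - \<i> * of_real (m r) * U r)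
          - (cis (m r) - 1 - \<i> * of_real (m r)) * U r)"
    proof -
      have "cis (- M (Suc r)) * cis (m r) = cis (- M r)" by (simp add: cis_mult M_def)
      then show ?thesis unfolding W_def by (simp add: algebra_simps)
    qed
    then have "cmod (W (Suc r) - W r) = cmod ((U (Suc r) - U r - \<i> * of_real (m r) * U r)
          - (cis (m r) - 1 - \<i> * of_real (m r)) * U r)"
      by (simp only: norm_mult norm_cis mult_1_left)
    also have "\<dots> \<le> cmod (U (Suc r) - U r - \<i> * of_real (m r) * U r)
          + cmod ((cis (m r) - 1 - \<i> * of_real (m r)) * U r)"
      by (rule norm_triangle_ineq4)
    also have "\<dots> \<le> g r * cmod (U r) + (m r)\<^sup>2 * cmod (U r)"
      unfolding norm_mult using assms(1)[OF that] cisb[of "m r"] by (intro add_mono mult_right_mono) auto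
    also have "\<dots> = (g r + (m r)\<^sup>2) * cmod (W r)" by (simp add: W_def norm_mult algebra_simps)
    finally show ?thesis .
  qed
  have "cmod (W n - W 0) \<le> (exp (\<Sum>r<n. g r + (m r)\<^sup>2) - 1) * cmod (W 0)"
    by (rule norm_diff_le_exp_sum) (use step assms(2) in auto)
  moreover have "U n - cis (M n) * U 0 = cis (M n) * (W n - W 0)"
    by (simp add: W_def M_def algebra_simps cis_mult mult.assoc[symmetric])
  ultimately show ?thesis by (simp add: norm_mult W_def M_def)
qed

subsection \<open>Windowed exponential sums\<close>

lemma geometric_sum_by_parts:
  fixes g :: "nat \<Rightarrow> complex"
  shows "(1 - \<mu>) * (\<Sum>i<j. g i * \<mu> ^ i) = g 0 + (\<Sum>i<j. (g (Suc i) - g i) * \<mu> ^ Suc i) - g j * \<mu> ^ j"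
proof (induction j)
  case (Suc j)
  show ?case
    unfolding sum.lessThan_Suc distrib_left Suc by (simp add: algebra_simps)
qed simp

text \<open>A parabola vanishes at both ends and has the constant second difference
  \<open>- 2 / T\<^sup>2\<close>, so two summations by parts over a whole block leave only terms of
  order \<open>1 / T\<close>.\<close>

definition window :: "nat \<Rightarrow> nat \<Rightarrow> real" where
  "window T j = real j * (real T - real j) / (real T)\<^sup>2"

lemma window_0 [simp]: "window T 0 = 0" and window_self [simp]: "window T T = 0"
  by (auto simp: window_def)

lemma window_bounds:
  assumes "j \<le> T"
  shows "0 \<le> window T j" "window T j \<le> 1/4"
proof -
  show "0 \<le> window T j" using assms by (simp add: window_def)
  have "4 * (real j * (real T - real j)) \<le> (real T)\<^sup>2"
    using zero_le_power2[of "real T - 2 * real j"] by (simp add: power2_eq_square algebra_simps)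
  then show "window T j \<le> 1/4"
    by (cases "T = 0") (auto simp: window_def field_simps)
qed

lemma window_diff:
  assumes "T > 0"
  shows "window T (Suc j) - window T j = (real T - 1 - 2 * real j) / (real T)\<^sup>2"
  using assms by (simp add: window_def field_simps)

lemma window_diff_bound:
  assumes "j < T"
  shows "\<bar>window T (Suc j) - window T j\<bar> \<le> 1 / real T"
proof -
  have "\<bar>real T - 1 - 2 * real j\<bar> \<le> real T" using assms by linarith
  then have "\<bar>real T - 1 - 2 * real j\<bar> / (real T)\<^sup>2 \<le> real T / (real T)\<^sup>2"
    by (intro divide_right_mono) auto
  then show ?thesis using assms by (simp add: window_diff power2_eq_square abs_mult)
qed

lemma sum_window_squares:
  assumes "T \<ge> 2"
  shows "real T / 40 \<le> (\<Sum>j<T. (window T j)\<^sup>2)"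
proof -
  \<comment> \<open>The upper limit \<open>n\<close> is separated from the parameter
    \<open>t\<close> to make the identity inductive; at \<open>n = t = T\<close> the sum collapses
    to \<open>(T^5 - T) / 30\<close>.\<close>
  have S: "30 * (\<Sum>j<n. (real j * (t - real j))\<^sup>2)
      = 5 * t\<^sup>2 * ((real n - 1) * real n * (2 * real n - 1)) - 15 * t * (real n * (real n - 1))\<^sup>2
        + real n * (real n - 1) * (2 * real n - 1) * (3 * (real n)\<^sup>2 - 3 * real n - 1)" for n t
    by (induction n) (simp_all add: algebra_simps power2_eq_square)
  have "30 * (\<Sum>j<T. (real j * (real T - real j))\<^sup>2) = (real T)^5 - real T"
    unfolding S by (simp add: algebra_simps power2_eq_square eval_nat_numeral)
  moreover have "(\<Sum>j<T. (window T j)\<^sup>2) = (\<Sum>j<T. (real j * (real T - real j))\<^sup>2) / (real T)^4"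
    by (simp add: window_def power_divide sum_divide_distrib flip: power_mult)
  ultimately have E: "(\<Sum>j<T. (window T j)\<^sup>2) = ((real T)^5 - real T) / (30 * (real T)^4)"
    by (metis (no_types) divide_divide_eq_left nonzero_mult_div_cancel_left zero_neq_numeral)
  have "2 ^ 4 \<le> (real T)^4" using assms by (intro power_mono) auto
  then have "4 * real T \<le> real T * (real T)^4" using assms by simp
  then have "30 * (real T * (real T) ^ 4) \<le> 40 * ((real T)^5 - real T)"
    by (simp add: eval_nat_numeral)
  then show ?thesis unfolding E using assms by (simp add: field_simps)
qed

section \<open>Summation by parts against powers of a unimodular number\<close>

context
  fixes T :: nat and \<mu> :: complex
  assumes T: "T > 0" and \<mu>: "cmod \<mu> = 1" "\<mu> \<noteq> 1"
begin

private definition "G = (\<lambda>j. \<Sum>i<j. of_real (window T i) * \<mu> ^ i)"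
private definition "E = (\<lambda>j. \<Sum>i<j. of_real (window T (Suc i) - window T i) * \<mu> ^ Suc i)"

private lemma GE: "(1 - \<mu>) * G j = E j - of_real (window T j) * \<mu> ^ j"
  unfolding G_def E_def using geometric_sum_by_parts[of \<mu> "\<lambda>i. of_real (window T i)" j] by simp

private lemma pos: "cmod (1 - \<mu>) > 0" using \<mu> by simp

private lemma E_le: "j \<le> T \<Longrightarrow> cmod (E j) \<le> 1"
proof -
  assume j: "j \<le> T"
  have "cmod (E j) \<le> (\<Sum>i<j. 1 / real T)"
    unfolding E_def
  proof (rule sum_norm_le)
    fix i assume "i \<in> {..<j}"
    then show "cmod (of_real (window T (Suc i) - window T i) * \<mu> ^ Suc i) \<le> 1 / real T"
      using window_diff_bound[of i T] j
      by (simp only: norm_mult norm_power \<mu> norm_of_real power_one mult_1_right lessThan_iff)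
  qed
  also have "\<dots> \<le> 1" using j T by simp
  finally show ?thesis .
qed

text \<open>A second summation by parts: the boundary values of the first difference contribute 1/T
  and 2/T, and the constant second difference contributes another 2/T.\<close>

private lemma E_le': "j \<le> T \<Longrightarrow> cmod (E j) \<le> 5 / (real T * cmod (1 - \<mu>))"
proof -
  assume j: "j \<le> T"
  define g where "g = (\<lambda>i. complex_of_real (window T (Suc i) - window T i))"
  \<comment> \<open>The index \<open>i = T\<close> is included because the boundary term
    \<open>g j\<close> occurs with \<open>j = T\<close>; there the difference is
    \<open>- (T + 1) / T\<^sup>2\<close>, whence the 2.\<close>
  have gb: "cmod (g i) \<le> 2 / real T" if "i \<le> T" for i
  proof -
    have "\<bar>real T - 1 - 2 * real i\<bar> \<le> 2 * real T" using that T by linarith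
    then have "\<bar>real T - 1 - 2 * real i\<bar> / (real T)\<^sup>2 \<le> 2 * real T / (real T)\<^sup>2"
      by (intro divide_right_mono) auto
    then show ?thesis unfolding g_def norm_of_real window_diff[OF T]
      using T by (simp add: power2_eq_square abs_mult)
  qed
  have gb0: "cmod (g 0) \<le> 1 / real T" 
    unfolding g_def norm_of_real using window_diff_bound[of 0 T] T by simp
  have g2: "g (Suc i) - g i = - of_real (2 / (real T)\<^sup>2)" for i
    unfolding g_def of_real_diff[symmetric] window_diff[OF T]
    by (simp add: diff_divide_distrib[symmetric])
  have "E j = \<mu> * (\<Sum>i<j. g i * \<mu> ^ i)"
    unfolding E_def g_def by (simp add: sum_distrib_left mult_ac)
  then have "cmod ((1 - \<mu>) * E j) = cmod ((1 - \<mu>) * (\<Sum>i<j. g i * \<mu> ^ i))"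
    by (simp add: norm_mult \<mu>)
  also have "\<dots> \<le> cmod (g 0) + cmod (\<Sum>i<j. (g (Suc i) - g i) * \<mu> ^ Suc i) + cmod (g j * \<mu> ^ j)"
    unfolding geometric_sum_by_parts by (meson norm_triangle_ineq norm_triangle_ineq4 order_trans add_right_mono)
  also have "\<dots> \<le> 1 / real T + 2 / real T + 2 / real T"
  proof (intro add_mono)
    have "cmod (\<Sum>i<j. (g (Suc i) - g i) * \<mu> ^ Suc i) \<le> (\<Sum>i<j. 2 / (real T)\<^sup>2)"
      by (rule sum_norm_le) (simp add: g2 norm_mult norm_power \<mu> norm_divide)
    also have "\<dots> = 2 * real j / (real T)\<^sup>2" by simp
    also have "\<dots> \<le> 2 * real T / (real T)\<^sup>2" using j by (intro divide_right_mono) auto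
    also have "\<dots> = 2 / real T" by (simp add: power2_eq_square)
    finally show "cmod (\<Sum>i<j. (g (Suc i) - g i) * \<mu> ^ Suc i) \<le> 2 / real T" .
    show "cmod (g j * \<mu> ^ j) \<le> 2 / real T"
      using gb[OF j] by (simp add: norm_mult norm_power \<mu>)
  qed (use gb0 in simp)
  finally have "cmod (1 - \<mu>) * cmod (E j) \<le> 5 / real T" by (simp add: norm_mult)
  then show ?thesis using pos T by (simp add: field_simps)
qed

lemma window_sum_le:
  assumes "j \<le> T"
  shows "cmod (\<Sum>i<j. of_real (window T i) * \<mu> ^ i) \<le> 2 / cmod (1 - \<mu>)"
proof -
  have "cmod ((1 - \<mu>) * G j) \<le> cmod (E j) + cmod (of_real (window T j) * \<mu> ^ j)"
    unfolding GE by (rule norm_triangle_ineq4)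
  also have "\<dots> \<le> 1 + 1"
    using E_le[OF assms] window_bounds[OF assms] by (intro add_mono) (auto simp: norm_mult norm_power \<mu>)
  finally have "cmod (1 - \<mu>) * cmod (G j) \<le> 2" by (simp add: norm_mult)
  then show ?thesis using pos unfolding G_def by (simp add: pos_le_divide_eq mult.commute)
qed

text \<open>At the end of the block the boundary term of the first summation by parts vanishes with
  the window, so that the second one can be exploited as well.\<close>

lemma window_full_sum_le:
  "cmod (\<Sum>i<T. of_real (window T i) * \<mu> ^ i) \<le> 5 / (real T * (cmod (1 - \<mu>))\<^sup>2)"
proof -
  have "cmod (1 - \<mu>) * cmod (G T) \<le> 5 / (real T * cmod (1 - \<mu>))"
    using E_le'[of T] GE[of T] by (simp add: norm_mult[symmetric])
  then show ?thesis using pos T by (simp add: G_def power2_eq_square field_simps)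
qed

text \<open>One summation by parts in the inner sum splits the double sum. The boundary terms pair
  with \<open>\<mu> ^ j\<close> to give the non-oscillating main term, the sum of squares over
  \<open>1 - cnj \<mu>\<close>; the rest is bounded by the second summation by parts.\<close>

lemma window_area:
  "cmod ((\<Sum>j<T. of_real (window T j) * \<mu> ^ j * cnj (\<Sum>i<j. of_real (window T i) * \<mu> ^ i))
      + of_real (\<Sum>j<T. (window T j)\<^sup>2) / (1 - cnj \<mu>)) \<le> 2 / (cmod (1 - \<mu>))\<^sup>2"
proof -
  define B where "B = (\<Sum>j<T. of_real (window T j) * \<mu> ^ j * cnj (G j))"
  have ll: "\<mu> ^ j * cnj \<mu> ^ j = 1" for j
    using \<mu> by (metis complex_norm_square mult.commute of_real_1 power_mult_distrib power_one)
  have ne: "1 - cnj \<mu> \<noteq> 0" using \<mu> by (metis complex_cnj_cnj complex_cnj_one eq_iff_diff_eq_0)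
  have "(1 - cnj \<mu>) * B = (\<Sum>j<T. of_real (window T j) * \<mu> ^ j * cnj (E j) - of_real ((window T j)\<^sup>2))"
    unfolding B_def sum_distrib_left
  proof (rule sum.cong[OF refl])
    fix j
    have "(1 - cnj \<mu>) * cnj (G j) = cnj (E j) - of_real (window T j) * cnj \<mu> ^ j"
      using arg_cong[OF GE[of j], of cnj] by simp
    then have "(1 - cnj \<mu>) * (of_real (window T j) * \<mu> ^ j * cnj (G j))
        = of_real (window T j) * \<mu> ^ j * (cnj (E j) - of_real (window T j) * cnj \<mu> ^ j)"
      by (metis mult.assoc mult.commute)
    also have "\<dots> = of_real (window T j) * \<mu> ^ j * cnj (E j) - of_real ((window T j)\<^sup>2) * (\<mu> ^ j * cnj \<mu> ^ j)"
      by (simp add: algebra_simps power2_eq_square)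
    finally show "(1 - cnj \<mu>) * (of_real (window T j) * \<mu> ^ j * cnj (G j))
        = of_real (window T j) * \<mu> ^ j * cnj (E j) - of_real ((window T j)\<^sup>2)" by (simp add: ll)
  qed
  then have eq: "(1 - cnj \<mu>) * (B + of_real (\<Sum>j<T. (window T j)\<^sup>2) / (1 - cnj \<mu>))
      = (\<Sum>j<T. of_real (window T j) * \<mu> ^ j * cnj (E j))"
    using ne by (simp add: distrib_left sum_subtractf)
  have "cmod (\<Sum>j<T. of_real (window T j) * \<mu> ^ j * cnj (E j)) \<le> (\<Sum>j<T. 1/4 * (5 / (real T * cmod (1 - \<mu>))))"
  proof (rule sum_norm_le)
    fix j assume "j \<in> {..<T}"
    then show "cmod (of_real (window T j) * \<mu> ^ j * cnj (E j)) \<le> 1/4 * (5 / (real T * cmod (1 - \<mu>)))"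
      using window_bounds[of j T] E_le'[of j] 
      by (simp only: norm_mult norm_power \<mu> complex_mod_cnj norm_of_real power_one mult_1_right) (intro mult_mono, auto)
  qed
  also have "\<dots> \<le> 2 / cmod (1 - \<mu>)" using T pos by (simp add: field_simps)
  finally have "cmod (1 - \<mu>) * cmod (B + of_real (\<Sum>j<T. (window T j)\<^sup>2) / (1 - cnj \<mu>)) \<le> 2 / cmod (1 - \<mu>)"
    unfolding eq[symmetric] norm_mult by (metis complex_cnj_diff complex_cnj_one complex_mod_cnj)
  then show ?thesis using pos by (simp add: B_def G_def power2_eq_square field_simps)
qed

end

text \<open>Comparison with the integral of the Lorentzian, telescoped through
  \<open>arctan\<close>. Uniformity in \<open>y\<close> and \<open>n\<close> makes the errors of all
  blocks of a stage together of the order of one resonant block.\<close>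

lemma sum_lorentz_le: "(\<Sum>r<n. 1 / (1 + (y - real r)\<^sup>2)) \<le> 10"
proof -
  have step: "1 / (1 + t\<^sup>2) \<le> 3 * (arctan (t + 1) - arctan t)" for t :: real
  proof -
    have "\<exists>\<xi>. t < \<xi> \<and> \<xi> < t + 1 \<and> arctan (t + 1) - arctan t = (t + 1 - t) * inverse (1 + \<xi>\<^sup>2)"
      by (rule MVT2) (auto intro!: derivative_eq_intros)
    then obtain \<xi> where \<xi>: "t < \<xi>" "\<xi> < t + 1" "arctan (t + 1) - arctan t = inverse (1 + \<xi>\<^sup>2)" by auto
    have "\<bar>\<xi>\<bar> \<le> \<bar>t\<bar> + 1" using \<xi> by linarith
    then have "\<xi>\<^sup>2 \<le> (\<bar>t\<bar> + 1)\<^sup>2" using power_mono[of "\<bar>\<xi>\<bar>" "\<bar>t\<bar> + 1" 2] by simp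
    also have "\<dots> \<le> 2 * t\<^sup>2 + 2"
      using zero_le_power2[of "\<bar>t\<bar> - 1"] by (simp add: power2_eq_square algebra_simps)
    also have "\<dots> \<le> 3 * t\<^sup>2 + 2" by simp
    finally have "1 + \<xi>\<^sup>2 \<le> 3 * (1 + t\<^sup>2)" by simp
    moreover have "0 < 1 + \<xi>\<^sup>2" "0 < 1 + t\<^sup>2" by (simp_all add: add_pos_nonneg)
    ultimately show ?thesis unfolding \<xi>(3) by (simp add: field_simps)
  qed
  have "(\<Sum>r<n. 1 / (1 + (y - real r)\<^sup>2)) \<le> (\<Sum>r<n. 3 * (arctan (y - real r + 1) - arctan (y - real r)))"
    by (intro sum_mono step)
  also have "\<dots> = 3 * (arctan (y + 1) - arctan (y - real n + 1))"
    by (induction n) (auto simp: algebra_simps)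
  also have "\<dots> \<le> 3 * pi"
    using arctan_bounded[of "y + 1"] arctan_bounded[of "y - real n + 1"] by simp
  also have "\<dots> \<le> 10" using pi_approx by simp
  finally show ?thesis .
qed

section \<open>Lower bounds for the sine and for chords of the circle\<close>

lemma abs_sin_minus_self_le:
  fixes y :: real
  shows "\<bar>sin y - y\<bar> \<le> 1/6 * \<bar>y\<bar> ^ 3"
proof -
  have "\<bar>sin y - (\<Sum>m<3. sin_coeff m * y ^ m)\<bar> \<le> inverse (fact 3) * \<bar>y\<bar> ^ 3"
    by (rule Maclaurin_sin_bound)
  moreover have "{..<3} = {0, 1, 2::nat}" by auto
  then have "(\<Sum>m<3. sin_coeff m * y ^ m) = y" by (simp add: sin_coeff_def)
  moreover have "inverse (fact 3) = (1/6 :: real)" by (simp add: fact_numeral)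
  ultimately show ?thesis by metis
qed

lemma abs_sin_ge:
  fixes y :: real
  assumes "\<bar>y\<bar> \<le> 19/10"
  shows "\<bar>y\<bar> / 3 \<le> \<bar>sin y\<bar>"
proof -
  note abs_sin_minus_self_le[of y]
  moreover have "\<bar>y\<bar> ^ 3 \<le> (19/10)\<^sup>2 * \<bar>y\<bar>"
  proof -
    have "\<bar>y\<bar> ^ 2 \<le> (19/10)\<^sup>2" using assms by (intro power_mono) auto
    then have "\<bar>y\<bar> ^ 2 * \<bar>y\<bar> \<le> (19/10)\<^sup>2 * \<bar>y\<bar>" by (rule mult_right_mono) auto
    then show ?thesis by (metis mult.commute power2_eq_square power3_eq_cube)
  qed
  ultimately have "\<bar>sin y - y\<bar> \<le> 1/6 * ((19/10)\<^sup>2 * \<bar>y\<bar>)" by linarith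
  then have "\<bar>sin y - y\<bar> \<le> 2/3 * \<bar>y\<bar>" by (simp add: power2_eq_square)
  then show ?thesis by linarith
qed

lemma cmod_one_minus_cis_sq: "(cmod (1 - cis x))\<^sup>2 = 2 * (1 - cos x)"
proof -
  have "(cmod (1 - cis x))\<^sup>2 = (1 - cos x)\<^sup>2 + (sin x)\<^sup>2"
    by (simp add: cmod_power2)
  also have "\<dots> = 2 * (1 - cos x)"
    using sin_cos_squared_add[of x] by (simp add: power2_eq_square algebra_simps)
  finally show ?thesis .
qed

text \<open>The range has to exceed pi + 1/2, the largest detuning between an argument within pi of
  1/2 and a frequency in [0, 1]; it stays below 2 pi, where the chord vanishes again.\<close>

lemma cmod_one_minus_cis_ge:
  assumes "\<bar>x\<bar> \<le> 19/5"
  shows "\<bar>x\<bar> / 3 \<le> cmod (1 - cis x)"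
proof -
  have "(cmod (1 - cis x))\<^sup>2 = (2 * sin (x/2))\<^sup>2"
    unfolding cmod_one_minus_cis_sq using cos_double_sin[of "x/2"] by (simp add: power2_eq_square algebra_simps)
  then have "cmod (1 - cis x) = 2 * \<bar>sin (x/2)\<bar>"
    by (metis abs_mult abs_norm_cancel abs_numeral power2_eq_iff_nonneg abs_ge_zero power2_abs)
  then show ?thesis using abs_sin_ge[of "x/2"] assms by simp
qed

text \<open>Telescoping of the squared moduli of the partial sums. The real part of the second-order
  term, which would change the modulus of the solution, thus depends only on the end point and on
  the sum of squares.\<close>

lemma two_Re_sum_cnj_partial_sums:
  fixes f :: "nat \<Rightarrow> complex"
  shows "2 * Re (\<Sum>j<n. f j * cnj (\<Sum>i<j. f i)) = (cmod (\<Sum>i<n. f i))\<^sup>2 - (\<Sum>i<n. (cmod (f i))\<^sup>2)"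
proof (induction n)
  case (Suc n)
  define F where "F = (\<Sum>i<n. f i)"
  have "(cmod (F + f n))\<^sup>2 = (cmod F)\<^sup>2 + (cmod (f n))\<^sup>2 + 2 * Re (f n * cnj F)"
    unfolding cmod_power2 by (simp add: power2_eq_square algebra_simps)
  then show ?case using Suc by (simp add: F_def)
qed simp

text \<open>The signed area swept, on one block, by the partial sums of the first-order increments; to
  second order it is the angle by which the block rotates the solution.\<close>
definition twist :: "real \<Rightarrow> nat \<Rightarrow> real \<Rightarrow> real" where
  "twist \<epsilon> T x = (\<epsilon> / real T)\<^sup>2 *
     Im (\<Sum>j<T. of_real (window T j) * cis x ^ j * cnj (\<Sum>i<j. of_real (window T i) * cis x ^ i))"

text \<open>The main term of \<open>window_area\<close> has imaginary part
  \<open>- S * sin x / D\<^sup>2\<close>, of one sign for all positive \<open>x\<close> in the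
  range, so angles before resonance add up without cancellation. The 80 is 40 * 2, from the sum of
  squares and from \<open>sin x / D\<^sup>2\<close>; the 18 is 2 * 9, from the chord bound.\<close>

lemma twist_ge:
  assumes "T \<ge> 2" "0 < x" "x \<le> 1"
  shows "\<epsilon>\<^sup>2 * (1 / (80 * (T * x)) - 18 / (T * x)\<^sup>2) \<le> twist \<epsilon> T x"
proof -
  define D where "D = cmod (1 - cis x)"
  define S where "S = (\<Sum>j<T. (window T j)\<^sup>2)"
  define B where "B = (\<Sum>j<T. of_real (window T j) * cis x ^ j * cnj (\<Sum>i<j. of_real (window T i) * cis x ^ i))"
  have Dx: "x / 3 \<le> D" using cmod_one_minus_cis_ge[of x] assms by (simp add: D_def)
  then have D0: "D > 0" using assms by linarith
  then have ne: "cis x \<noteq> 1" by (auto simp: D_def)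
  have D2: "D\<^sup>2 = 2 * (1 - cos x)" unfolding D_def by (rule cmod_one_minus_cis_sq)
  have area: "cmod (B + of_real S / (1 - cnj (cis x))) \<le> 2 / D\<^sup>2"
    unfolding B_def S_def D_def by (rule window_area) (use assms ne in auto)
  have "Im (of_real S / (1 - cnj (cis x))) = - (S * sin x / D\<^sup>2)"
  proof -
    have "(1 - cos x)\<^sup>2 + (sin x)\<^sup>2 = D\<^sup>2"
      using D2 sin_cos_squared_add[of x] by (simp add: power2_eq_square algebra_simps)
    then show ?thesis by (simp add: Im_divide)
  qed
  then have ImB: "Im B \<ge> S * sin x / D\<^sup>2 - 2 / D\<^sup>2"
    using area abs_Im_le_cmod[of "B + of_real S / (1 - cnj (cis x))"] by simp
  have "D\<^sup>2 \<le> x\<^sup>2"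
  proof -
    have "D\<^sup>2 = (2 * sin (x/2))\<^sup>2"
      using D2 cos_double_sin[of "x/2"] by (simp add: power2_eq_square algebra_simps)
    also have "\<dots> \<le> (2 * (x/2))\<^sup>2"
      using assms by (intro power_mono mult_left_mono sin_x_le_x mult_nonneg_nonneg sin_ge_zero) (use pi_gt3 in auto)
    finally show ?thesis by simp
  qed
  moreover have sinx: "x / 2 \<le> sin x"
  proof -
    have "x ^ 3 \<le> x" using assms power_decreasing[of 1 3 x] by simp
    moreover have "\<bar>sin x - x\<bar> \<le> 1/6 * x ^ 3" using abs_sin_minus_self_le[of x] assms by simp
    ultimately show ?thesis using assms by linarith
  qed
  ultimately have 1: "1 / (2 * x) \<le> sin x / D\<^sup>2"
  proof -
    assume a: "D\<^sup>2 \<le> x\<^sup>2" "x / 2 \<le> sin x"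
    have "1 / (2 * x) = (x / 2) / x\<^sup>2" using assms by (simp add: power2_eq_square)
    also have "\<dots> \<le> sin x / D\<^sup>2" using a D0 assms by (intro frac_le) auto
    finally show ?thesis .
  qed
  have S: "real T / 40 \<le> S" unfolding S_def by (rule sum_window_squares) (use assms in simp)
  have "real T / 40 * (1 / (2 * x)) \<le> S * (sin x / D\<^sup>2)"
    using 1 S assms by (intro mult_mono) auto
  moreover have "2 / D\<^sup>2 \<le> 18 / x\<^sup>2"
  proof -
    have "(x/3)\<^sup>2 \<le> D\<^sup>2" using Dx assms by (intro power_mono) auto
    then have "2 / D\<^sup>2 \<le> 2 / (x/3)\<^sup>2" using assms D0 by (intro divide_left_mono mult_pos_pos) auto
    then show ?thesis by (simp add: power_divide)
  qed
  ultimately have "real T / (80 * x) - 18 / x\<^sup>2 \<le> Im B" using ImB by simp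
  then have "(\<epsilon> / real T)\<^sup>2 * (real T / (80 * x) - 18 / x\<^sup>2) \<le> twist \<epsilon> T x"
    unfolding twist_def B_def[symmetric] by (intro mult_left_mono) auto
  moreover have "(\<epsilon> / real T)\<^sup>2 * (real T / (80 * x) - 18 / x\<^sup>2) = \<epsilon>\<^sup>2 * (1 / (80 * (T * x)) - 18 / (T * x)\<^sup>2)"
    using assms by (simp add: power2_eq_square field_simps)
  ultimately show ?thesis by simp
qed

text \<open>Near resonance the trivial bound \<epsilon> is used; away from it both
  \<open>F T\<close> and the squares of all partial sums decay like
  \<open>1 / (T * x)\<^sup>2\<close>. So the errors are controlled by the Lorentzian
  \<open>q\<close>, up to a term of order 1/T. The angle itself decays only like the first power, so
  it is kept explicit and only its square is estimated by \<open>q\<close>.\<close>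

lemma block_estimate:
  fixes u :: "nat \<Rightarrow> complex" and T :: nat and \<epsilon> x :: real and \<kappa> :: complex
  defines "f \<equiv> \<lambda>j. \<kappa> * of_real (\<epsilon> / real T * window T j) * cis x ^ j"
  defines "q \<equiv> 1 / (1 + (real T * x)\<^sup>2)"
  assumes T: "T > 0" and \<epsilon>: "0 < \<epsilon>" "\<epsilon> \<le> 1" and \<kappa>: "cmod \<kappa> = 1" and x: "\<bar>x\<bar> \<le> 19/5"
    and rec: "\<And>j. j < T \<Longrightarrow> u (Suc j) = u j + f j * cnj (u j)"
  shows "\<And>j. j \<le> T \<Longrightarrow> cmod (u j) \<le> 3 * cmod (u 0)"
    and "cmod (u T - u 0 - \<i> * of_real (twist \<epsilon> T x) * u 0) \<le> \<epsilon> * (1206 * q + 1 / real T) * cmod (u 0)"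
    and "(twist \<epsilon> T x)\<^sup>2 \<le> 72 * \<epsilon> * q" and "\<bar>twist \<epsilon> T x\<bar> \<le> 1"
proof -
  define a where "a = \<epsilon> / real T"
  have a: "0 < a" using T \<epsilon> by (simp add: a_def)
  have aT: "a * real T = \<epsilon>" using T by (simp add: a_def)
  define F where "F = (\<lambda>j. \<Sum>i<j. f i)"
  define G where "G = (\<lambda>j. \<Sum>i<j. of_real (window T i) * cis x ^ i)"
  have FG: "F j = \<kappa> * of_real a * G j" for j
    by (simp add: F_def G_def f_def a_def sum_distrib_left mult_ac)
  have nF: "cmod (F j) = a * cmod (G j)" for j using a by (simp add: FG norm_mult \<kappa>)
  have nf: "cmod (f j) = a * window T j" if "j \<le> T" for j
    unfolding f_def a_def[symmetric] norm_mult norm_power \<kappa> norm_of_real norm_cis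
    using window_bounds[OF that] a by simp
  have q0: "0 < q" unfolding q_def by (simp add: add_pos_nonneg)
  have fa: "cmod (f j) \<le> a" if "j \<le> T" for j
    using nf[OF that] window_bounds[OF that] a by simp
  have s: "(\<Sum>i<T. cmod (f i)) \<le> \<epsilon>"
  proof -
    have "(\<Sum>i<T. cmod (f i)) \<le> (\<Sum>i<T. a)" by (intro sum_mono fa) auto
    then show ?thesis using aT by (simp add: mult.commute)
  qed
  have F1: "cmod (F j) \<le> \<epsilon>" if "j \<le> T" for j
  proof -
    have "cmod (F j) \<le> (\<Sum>i<j. a)" unfolding F_def by (intro sum_norm_le fa) (use that in auto)
    also have "\<dots> \<le> (real T) * a" using that a by simp
    finally show ?thesis using aT by (simp add: mult.commute)
  qed
  define t where "t = real T * x"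
  have qt: "q = 1 / (1 + t\<^sup>2)" by (simp add: q_def t_def)
  have pos: "0 < 1 + t\<^sup>2" by (simp add: add_pos_nonneg)
  have TD: "real T * cmod (1 - cis x) \<ge> \<bar>t\<bar> / 3"
    using mult_left_mono[OF cmod_one_minus_cis_ge[OF x], of "real T"] by (simp add: t_def abs_mult)
  have ne: "cis x \<noteq> 1" if "t \<noteq> 0" using TD that by auto
  \<comment> \<open>Beyond \<open>t\<^sup>2 = 36\<close> the windowed sum gives
    \<open>36 / t\<^sup>2\<close>, with 36 the square of 2 * 3: the 2 from
    \<open>window_sum_le\<close>, the 3 from the chord bound. In \<open>FT\<close> the constant is
    45 = 5 * 9 in the same way.\<close>
  have F2: "(cmod (F j))\<^sup>2 \<le> 72 * \<epsilon>\<^sup>2 * q" if j: "j \<le> T" for j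
  proof (cases "t\<^sup>2 \<le> 36")
    case True
    have "1 \<le> 72 * q" using True by (simp add: qt pos field_simps)
    then have "\<epsilon>\<^sup>2 * 1 \<le> \<epsilon>\<^sup>2 * (72 * q)" by (intro mult_left_mono) auto
    moreover have "(cmod (F j))\<^sup>2 \<le> \<epsilon>\<^sup>2" using F1[OF j] by (intro power_mono) auto
    ultimately show ?thesis by (simp add: algebra_simps)
  next
    case False
    then have t: "t \<noteq> 0" by auto
    have "cmod (F j) \<le> a * (2 / cmod (1 - cis x))"
      unfolding nF G_def using a by (intro mult_left_mono window_sum_le) (use T ne[OF t] j in auto)
    also have "\<dots> = 2 * \<epsilon> / (real T * cmod (1 - cis x))" using T by (simp add: a_def)
    also have "\<dots> \<le> 2 * \<epsilon> / (\<bar>t\<bar> / 3)" using TD t T \<epsilon> by (intro divide_left_mono mult_pos_pos) auto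
    finally have "(cmod (F j))\<^sup>2 \<le> (2 * \<epsilon> / (\<bar>t\<bar> / 3))\<^sup>2" by (intro power_mono) auto
    also have "\<dots> = \<epsilon>\<^sup>2 * (36 / t\<^sup>2)" by (simp add: power_divide power_mult_distrib)
    also have "\<dots> \<le> \<epsilon>\<^sup>2 * (72 * q)"
      using False t by (intro mult_left_mono) (auto simp: qt pos divide_simps)
    finally show ?thesis by (simp add: algebra_simps)
  qed
  have FT: "cmod (F T) \<le> 90 * \<epsilon> * q"
  proof (cases "t\<^sup>2 \<le> 45")
    case True
    have "1 \<le> 90 * q" using True by (simp add: qt pos field_simps)
    then have "\<epsilon> * 1 \<le> \<epsilon> * (90 * q)" using \<epsilon> by (intro mult_left_mono) auto
    then show ?thesis using F1[of T] by (simp add: algebra_simps)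
  next
    case False
    then have t: "t \<noteq> 0" by auto
    have "cmod (F T) \<le> a * (5 / (real T * (cmod (1 - cis x))\<^sup>2))"
      unfolding nF G_def using a by (intro mult_left_mono window_full_sum_le) (use T ne[OF t] in auto)
    also have "\<dots> = 5 * \<epsilon> / (real T * cmod (1 - cis x))\<^sup>2" using T by (simp add: a_def power2_eq_square mult_ac)
    also have "\<dots> \<le> 5 * \<epsilon> / (\<bar>t\<bar> / 3)\<^sup>2" using TD t T \<epsilon> by (intro divide_left_mono mult_pos_pos power_mono) auto
    also have "\<dots> = \<epsilon> * (45 / t\<^sup>2)" by (simp add: power_divide)
    also have "\<dots> \<le> \<epsilon> * (90 * q)"
      using False t \<epsilon> by (intro mult_left_mono) (auto simp: qt pos divide_simps)
    finally show ?thesis by (simp add: algebra_simps)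
  qed
  \<comment> \<open>One bound for all partial sums that is at most 1, as the expansion requires, and
    has a square of the order of \<open>q\<close>.\<close>
  define \<rho> where "\<rho> = \<epsilon> * min 1 (sqrt (72 * q))"
  have \<rho>0: "0 \<le> \<rho>" and \<rho>\<epsilon>: "\<rho> \<le> \<epsilon>" using \<epsilon> q0 by (auto simp: \<rho>_def mult_le_cancel_left1)
  have \<rho>2: "\<rho>\<^sup>2 \<le> 72 * \<epsilon>\<^sup>2 * q"
  proof -
    have "\<rho> \<le> \<epsilon> * sqrt (72 * q)" unfolding \<rho>_def using \<epsilon> by (intro mult_left_mono) auto
    then have "\<rho>\<^sup>2 \<le> (\<epsilon> * sqrt (72 * q))\<^sup>2" using \<rho>0 by (intro power_mono)
    then show ?thesis using q0 by (simp add: power_mult_distrib)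
  qed
  have F\<rho>: "cmod (F j) \<le> \<rho>" if "j \<le> T" for j
  proof -
    have "cmod (F j) \<le> sqrt (72 * \<epsilon>\<^sup>2 * q)" using F2[OF that] real_le_rsqrt by blast
    also have "\<dots> = \<epsilon> * sqrt (72 * q)" using \<epsilon> by (simp add: real_sqrt_mult mult_ac)
    finally show ?thesis using F1[OF that] by (simp add: \<rho>_def min_def)
  qed
  define B where "B = (\<Sum>j<T. f j * cnj (F j))"
  have ImB: "Im B = twist \<epsilon> T x"
  proof -
    \<comment> \<open>The unimodular factor cancels against its conjugate: the enclosed area is
      independent of the phase with which the block starts.\<close>
    have "f j * cnj (F j) = of_real (a\<^sup>2) * (of_real (window T j) * cis x ^ j * cnj (G j))" for j
    proof -
      have "f j * cnj (F j) = (\<kappa> * cnj \<kappa>) * of_real (a\<^sup>2) * (of_real (window T j) * cis x ^ j * cnj (G j))"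
        by (simp add: FG f_def a_def[symmetric] power2_eq_square mult_ac)
      moreover have "\<kappa> * cnj \<kappa> = 1" using \<kappa> by (metis complex_norm_square of_real_1 power_one)
      ultimately show ?thesis by simp
    qed
    then have "B = of_real (a\<^sup>2) * (\<Sum>j<T. of_real (window T j) * cis x ^ j * cnj (G j))"
      by (simp add: B_def sum_distrib_left)
    then show ?thesis by (simp add: twist_def G_def a_def del: of_real_power)
  qed
  have Bb: "cmod B \<le> \<epsilon> * \<rho>"
  proof -
    have "cmod B \<le> (\<Sum>j<T. cmod (f j) * \<rho>)"
      unfolding B_def by (intro sum_norm_le) (auto simp: norm_mult intro!: mult_left_mono F\<rho>)
    also have "\<dots> \<le> \<epsilon> * \<rho>" using s \<rho>0 by (simp add: sum_distrib_right[symmetric] mult_right_mono)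
    finally show ?thesis .
  qed
  have \<epsilon>2: "\<epsilon>\<^sup>2 \<le> \<epsilon>" using \<epsilon> by (simp add: power2_eq_square mult_left_le)
  have \<epsilon>2q: "\<epsilon>\<^sup>2 * q \<le> \<epsilon> * q" using \<epsilon>2 q0 by (intro mult_right_mono) auto
  have tw: "\<bar>twist \<epsilon> T x\<bar> \<le> \<epsilon> * \<rho>" using Bb abs_Im_le_cmod[of B] ImB by simp
  also have "\<dots> \<le> 1 * \<rho>" using \<epsilon> \<rho>0 by (intro mult_right_mono) auto
  finally have tw\<rho>: "\<bar>twist \<epsilon> T x\<bar> \<le> \<rho>" by simp
  then show "\<bar>twist \<epsilon> T x\<bar> \<le> 1" using \<rho>\<epsilon> \<epsilon> by simp
  have "(twist \<epsilon> T x)\<^sup>2 \<le> \<rho>\<^sup>2" using power_mono[OF tw\<rho>, of 2] by simp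
  then show "(twist \<epsilon> T x)\<^sup>2 \<le> 72 * \<epsilon> * q" using \<rho>2 \<epsilon>2q by (simp add: algebra_simps)
  have ReB: "\<bar>Re B\<bar> \<le> 36 * (\<epsilon> * q) + \<epsilon> / real T"
  proof -
    have "2 * Re B = (cmod (F T))\<^sup>2 - (\<Sum>i<T. (cmod (f i))\<^sup>2)"
      unfolding B_def F_def by (rule two_Re_sum_cnj_partial_sums)
    moreover have "(\<Sum>i<T. (cmod (f i))\<^sup>2) \<le> \<epsilon> / real T"
    proof -
      have "(\<Sum>i<T. (cmod (f i))\<^sup>2) \<le> (\<Sum>i<T. a\<^sup>2)" by (intro sum_mono power_mono fa) auto
      also have "\<dots> = \<epsilon>\<^sup>2 / real T" using T by (simp add: a_def power2_eq_square)
      also have "\<dots> \<le> \<epsilon> / real T" using \<epsilon>2 by (intro divide_right_mono) auto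
      finally show ?thesis .
    qed
    moreover have "0 \<le> (\<Sum>i<T. (cmod (f i))\<^sup>2)" by (intro sum_nonneg) auto
    moreover have "(cmod (F T))\<^sup>2 \<le> 72 * (\<epsilon> * q)" using F2[of T] \<epsilon>2q by simp
    moreover have "0 \<le> \<epsilon> * q" "0 \<le> \<epsilon> / real T" using \<epsilon> q0 by auto
    ultimately show ?thesis using zero_le_power2[of "cmod (F T)"] by linarith
  qed
  have exp1: "\<And>j. j \<le> T \<Longrightarrow> cmod (u j) \<le> 3 * cmod (u 0)"
    by (rule conj_recursion_expansion(1)[of T u f \<rho>])
       (use rec F\<rho> \<rho>\<epsilon> s \<epsilon> in \<open>auto simp: F_def\<close>)
  then show "\<And>j. j \<le> T \<Longrightarrow> cmod (u j) \<le> 3 * cmod (u 0)" .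
  have exp2: "cmod (u T - u 0 - F T * cnj (u 0) - B * u 0) \<le> 15 * \<rho>\<^sup>2 * cmod (u 0)"
    unfolding B_def F_def
    by (rule conj_recursion_expansion(2)[of T u f \<rho>])
       (use rec F\<rho> \<rho>\<epsilon> s \<epsilon> in \<open>auto simp: F_def\<close>)
  have Bsplit: "B = of_real (Re B) + \<i> * of_real (twist \<epsilon> T x)" using ImB complex_eq[of B] by simp
  have "u T - u 0 - \<i> * of_real (twist \<epsilon> T x) * u 0
      = (u T - u 0 - F T * cnj (u 0) - B * u 0) + (F T * cnj (u 0) + of_real (Re B) * u 0)"
    using arg_cong[OF Bsplit, of "\<lambda>b. b * u 0"] by (simp add: algebra_simps)
  then have "cmod (u T - u 0 - \<i> * of_real (twist \<epsilon> T x) * u 0)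
      \<le> cmod (u T - u 0 - F T * cnj (u 0) - B * u 0) + (cmod (F T * cnj (u 0)) + cmod (of_real (Re B) * u 0))"
    by (metis norm_triangle_ineq norm_triangle_mono order_refl)
  also have "\<dots> \<le> 15 * \<rho>\<^sup>2 * cmod (u 0) + (90 * \<epsilon> * q * cmod (u 0) + (36 * (\<epsilon> * q) + \<epsilon> / real T) * cmod (u 0))"
    using exp2 FT ReB by (intro add_mono) (auto simp: norm_mult intro!: mult_right_mono)
  also have "\<dots> = (15 * \<rho>\<^sup>2 + (90 * \<epsilon> * q + (36 * (\<epsilon> * q) + \<epsilon> / real T))) * cmod (u 0)"
    by (simp add: algebra_simps)
  \<comment> \<open>1206 = 15 * 72 + 90 + 36: the third-order remainder, the first-order term and
    the real second-order part.\<close>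
  also have "\<dots> \<le> (\<epsilon> * (1206 * q + 1 / real T)) * cmod (u 0)"
    using \<rho>2 \<epsilon>2q by (intro mult_right_mono) (simp_all add: algebra_simps)
  finally show "cmod (u T - u 0 - \<i> * of_real (twist \<epsilon> T x) * u 0) \<le> \<epsilon> * (1206 * q + 1 / real T) * cmod (u 0)" .
qed

subsection \<open>One stage of the construction\<close>

text \<open>A discrete chirp: on the \<open>r\<close>-th block of length \<open>T\<close> the frequency is \<open>r / T\<close>. The window makes the
  first-order displacement of a block decay quadratically in the distance from resonance, while the
  enclosed area decays only like its reciprocal. Hence the displacements sum to \<open>O(\<epsilon>)\<close>, and the rotation
  angles accumulated before resonance to a multiple of \<open>\<epsilon>\<^sup>2 ln T\<close>.\<close>
definition stage_coeff :: "real \<Rightarrow> nat \<Rightarrow> nat \<Rightarrow> complex" where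
  "stage_coeff \<epsilon> T n = of_real (\<epsilon> / real T * window T (n mod T)) * cis (- (real (n div T) / real T * real (n mod T)))"

lemma cmod_stage_coeff_le:
  assumes "T > 0" "0 \<le> \<epsilon>"
  shows "cmod (stage_coeff \<epsilon> T n) \<le> \<epsilon> / real T"
proof -
  have w: "\<bar>window T (n mod T)\<bar> \<le> 1"
    using window_bounds[of "n mod T" T] assms by simp
  have "cmod (stage_coeff \<epsilon> T n) = \<epsilon> / real T * \<bar>window T (n mod T)\<bar>"
    unfolding stage_coeff_def norm_mult norm_of_real norm_cis using assms by (simp add: abs_mult)
  also have "\<dots> \<le> \<epsilon> / real T * 1" using w assms by (intro mult_left_mono) auto
  finally show ?thesis by simp
qed

context
  fixes T :: nat and \<epsilon> \<theta> :: real and \<kappa> :: complex and u :: "nat \<Rightarrow> complex"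
  assumes T: "T \<ge> 2" and \<epsilon>: "0 < \<epsilon>" "\<epsilon> \<le> 1/312000" and \<kappa>: "cmod \<kappa> = 1"
    and \<theta>: "\<bar>\<theta> - 1/2\<bar> \<le> pi"
    and rec: "\<And>j. j < T * T \<Longrightarrow> u (Suc j) = u j + stage_coeff \<epsilon> T j * cis \<theta> ^ j * \<kappa> * cnj (u j)"
begin

private definition "q = (\<lambda>r. 1 / (1 + (real T * \<theta> - real r)\<^sup>2))"

text \<open>The phase \<open>cis \<theta> ^ (r * T)\<close> collected before the block is constant
  on it and is absorbed into the unimodular factor of \<open>block_estimate\<close>; what remains
  oscillates with the detuning \<open>\<theta> - r / T\<close>.\<close>

private lemma block:
  assumes r: "r < T"
  shows "\<And>j. j \<le> T \<Longrightarrow> cmod (u (r * T + j)) \<le> 3 * cmod (u (r * T))"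
    and "cmod (u (Suc r * T) - u (r * T) - \<i> * of_real (twist \<epsilon> T (\<theta> - real r / real T)) * u (r * T))
       \<le> \<epsilon> * (1206 * q r + 1 / real T) * cmod (u (r * T))"
    and "(twist \<epsilon> T (\<theta> - real r / real T))\<^sup>2 \<le> 72 * \<epsilon> * q r"
    and "\<bar>twist \<epsilon> T (\<theta> - real r / real T)\<bar> \<le> 1"
proof -
  define x where "x = \<theta> - real r / real T"
  define k where "k = cis \<theta> ^ (r * T) * \<kappa>"
  have k: "cmod k = 1" by (simp add: k_def norm_mult norm_power \<kappa>)
  have pi33: "pi \<le> 33/10" using pi_approx by simp
  have "0 \<le> real r / real T" "real r / real T \<le> 1" using r by auto
  then have x: "\<bar>x\<bar> \<le> 19/5" unfolding x_def using \<theta> pi33 by linarith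
  have Tx: "real T * x = real T * \<theta> - real r" using T by (simp add: x_def algebra_simps)
  have rec': "u (r * T + Suc j) = u (r * T + j) + k * of_real (\<epsilon> / real T * window T j) * cis x ^ j * cnj (u (r * T + j))"
    if j: "j < T" for j
  proof -
    have "Suc r * T \<le> T * T" using r by (intro mult_right_mono) auto
    then have lt: "r * T + j < T * T" using j by simp
    have md: "(r * T + j) mod T = j" "(r * T + j) div T = r" using j by auto
    have "cis x ^ j = cis \<theta> ^ j * cis (- (real r / real T * real j))"
      unfolding x_def Complex.DeMoivre cis_mult by (rule arg_cong[where f = cis]) (simp add: algebra_simps)
    then show ?thesis
      using rec[OF lt, unfolded stage_coeff_def md] by (simp add: k_def power_add mult_ac)
  qed
  note be = block_estimate[of T \<epsilon> k x "\<lambda>j. u (r * T + j)", unfolded Tx]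
  have T0: "T > 0" and e1: "\<epsilon> \<le> 1" using T \<epsilon> by auto
  show "cmod (u (r * T + j)) \<le> 3 * cmod (u (r * T))" if "j \<le> T" for j
    using be(1)[OF T0 \<epsilon>(1) e1 k x rec' that] by simp
  show "cmod (u (Suc r * T) - u (r * T) - \<i> * of_real (twist \<epsilon> T (\<theta> - real r / real T)) * u (r * T))
       \<le> \<epsilon> * (1206 * q r + 1 / real T) * cmod (u (r * T))"
    using be(2)[OF T0 \<epsilon>(1) e1 k x rec'] by (simp add: q_def x_def add.commute)
  show "(twist \<epsilon> T (\<theta> - real r / real T))\<^sup>2 \<le> 72 * \<epsilon> * q r"
    using be(3)[OF T0 \<epsilon>(1) e1 k x rec'] by (simp add: q_def x_def)
  show "\<bar>twist \<epsilon> T (\<theta> - real r / real T)\<bar> \<le> 1"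
    using be(4)[OF T0 \<epsilon>(1) e1 k x rec'] by (simp add: x_def)
qed

text \<open>In the rotating frame the block errors are \<epsilon> times Lorentzians centred at
  resonance, plus \<epsilon>/T per block; both sum to a multiple of \<epsilon> independent of
  \<open>T\<close>.\<close>

lemma stage_rotation:
  assumes "r \<le> T"
  shows "cmod (u (r * T) - cis (\<Sum>s<r. twist \<epsilon> T (\<theta> - real s / real T)) * u 0) \<le> 26000 * \<epsilon> * cmod (u 0)"
proof -
  define m where "m = (\<lambda>s. twist \<epsilon> T (\<theta> - real s / real T))"
  define g where "g = (\<lambda>s. \<epsilon> * (1206 * q s + 1 / real T))"
  have q0: "0 \<le> q s" for s by (simp add: q_def)
  have "cmod (u (r * T) - cis (\<Sum>s<r. m s) * u (0 * T))
      \<le> (exp (\<Sum>s<r. g s + (m s)\<^sup>2) - 1) * cmod (u (0 * T))"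
    by (rule rotation_recursion[of r "\<lambda>r. u (r * T)"])
       (use block(2) assms \<epsilon> q0 in \<open>auto simp: m_def g_def\<close>)
  also have "\<dots> \<le> (26000 * \<epsilon>) * cmod (u (0 * T))"
  proof (rule mult_right_mono)
    \<comment> \<open>1278 = 1206 + 72, the 72 coming from the squared angles. With the Lorentzian
      sum at most 10 the total 1278 * 10 + 1 is below 13000, and passing through \<open>exp\<close>
      at most doubles it.\<close>
    have "(\<Sum>s<r. g s + (m s)\<^sup>2) \<le> (\<Sum>s<r. \<epsilon> * (1278 * q s) + \<epsilon> / real T)"
    proof (rule sum_mono)
      fix s assume "s \<in> {..<r}"
      then show "g s + (m s)\<^sup>2 \<le> \<epsilon> * (1278 * q s) + \<epsilon> / real T"
        using block(3)[of s] assms by (simp add: g_def m_def algebra_simps)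
    qed
    also have "\<dots> = \<epsilon> * (1278 * (\<Sum>s<r. q s)) + \<epsilon> * (real r / real T)"
      by (simp add: sum.distrib sum_distrib_left)
    also have "\<dots> \<le> \<epsilon> * (1278 * 10) + \<epsilon> * 1"
      using sum_lorentz_le[where n = r and y = "real T * \<theta>"] assms T \<epsilon>
      by (intro add_mono mult_left_mono) (auto simp: q_def)
    finally have "(\<Sum>s<r. g s + (m s)\<^sup>2) \<le> 13000 * \<epsilon>" using \<epsilon> by simp
    then have "exp (\<Sum>s<r. g s + (m s)\<^sup>2) \<le> exp (13000 * \<epsilon>)" by simp
    also have "\<dots> \<le> 1 + 2 * (13000 * \<epsilon>)" by (rule real_exp_bound_lemma) (use \<epsilon> in auto)
    finally show "exp (\<Sum>s<r. g s + (m s)\<^sup>2) - 1 \<le> 26000 * \<epsilon>" by simp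
  qed simp
  finally show ?thesis by (simp add: m_def)
qed

lemma stage_norm_end: "\<bar>cmod (u (T * T)) - cmod (u 0)\<bar> \<le> 26000 * \<epsilon> * cmod (u 0)"
proof -
  have "\<bar>cmod (u (T * T)) - cmod (cis (\<Sum>s<T. twist \<epsilon> T (\<theta> - real s / real T)) * u 0)\<bar>
     \<le> 26000 * \<epsilon> * cmod (u 0)"
    using stage_rotation[of T] by (meson norm_triangle_ineq3 order_refl order_trans)
  then show ?thesis by (simp add: norm_mult)
qed

text \<open>6 = 2 * 3: at block starts the modulus is at most twice the initial one, and inside a
  block it grows by at most the factor 3.\<close>

lemma stage_norm_le:
  assumes "j \<le> T * T"
  shows "cmod (u j) \<le> 6 * cmod (u 0)"
proof -
  \<comment> \<open>The end point \<open>T * T\<close> is assigned to the last block, since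
    \<open>j div T\<close> would give the nonexistent block \<open>T\<close>.\<close>
  define r where "r = (if j = T * T then T - 1 else j div T)"
  have rT: "r < T" and jr: "r * T \<le> j" "j - r * T \<le> T"
  proof -
    show "r < T" using assms T by (auto simp: r_def less_mult_imp_div_less)
    show "r * T \<le> j" using assms T by (auto simp: r_def)
    show "j - r * T \<le> T"
    proof (cases "j = T * T")
      case True
      then show ?thesis using T by (simp add: r_def diff_mult_distrib)
    next
      case False
      have "j - j div T * T = j mod T" by (simp add: minus_div_mult_eq_mod)
      moreover have "j mod T \<le> T" using T by (simp add: less_imp_le)
      ultimately show ?thesis using False by (simp add: r_def)
    qed
  qed
  have "cmod (u (r * T)) \<le> cmod (cis (\<Sum>s<r. twist \<epsilon> T (\<theta> - real s / real T)) * u 0) + 26000 * \<epsilon> * cmod (u 0)"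
    using stage_rotation[of r] rT norm_triangle_sub[of "u (r * T)" "cis (\<Sum>s<r. twist \<epsilon> T (\<theta> - real s / real T)) * u 0"]
    by simp
  also have "\<dots> \<le> cmod (u 0) + 1 * cmod (u 0)"
    unfolding norm_mult norm_cis using \<epsilon> by (intro add_mono mult_right_mono) auto
  finally have "cmod (u (r * T)) \<le> 2 * cmod (u 0)" by simp
  moreover have "cmod (u j) \<le> 3 * cmod (u (r * T))" using block(1)[OF rT jr(2)] jr(1) by simp
  ultimately show ?thesis by simp
qed

text \<open>For such \<theta> resonance occurs near block \<open>T * \<theta>\<close>, in the second
  half of the stage. The angles before it have one sign and dominate a harmonic sum, so the total
  angle reaches 1, while the modulus is nearly unchanged.\<close>

lemma stage_moves:
  assumes \<theta>1: "1/2 \<le> \<theta>" "\<theta> \<le> 1"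
    and T0: "T = 2 * T0" "160 / \<epsilon>\<^sup>2 + harm 2880 \<le> harm T0"
  shows "\<exists>j\<le>T * T. cmod (u 0) / 4 \<le> cmod (u j - u 0)"
proof -
  define m where "m = (\<lambda>s. twist \<epsilon> T (\<theta> - real s / real T))"
  define M where "M = (\<lambda>r. \<Sum>s<r. m s)"
  define p where "p = nat \<lceil>real T * \<theta>\<rceil>"
  have T\<theta>: "real T0 \<le> real T * \<theta>" "real T * \<theta> \<le> real T"
    using \<theta>1 mult_left_mono[of "1/2" \<theta> "real T"] mult_left_mono[of \<theta> 1 "real T"] T0 by auto
  have p1: "real T * \<theta> \<le> real p" "real p < real T * \<theta> + 1"
    using T\<theta> unfolding p_def by linarith+
  then have p2: "T0 \<le> p" "p \<le> T" using T\<theta> by linarith+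
  have harmp: "160 / \<epsilon>\<^sup>2 + harm 2880 \<le> (harm p :: real)" using T0 harm_mono[OF p2(1), where 'a = real] by simp
  have p3: "2880 < p"
  proof (rule ccontr)
    assume "\<not> 2880 < p"
    then have "harm p \<le> (harm 2880 :: real)" by (intro harm_mono) auto
    moreover have "0 < 160 / \<epsilon>\<^sup>2" using \<epsilon> by simp
    ultimately show False using harmp by simp
  qed
  have m_ge: "\<epsilon>\<^sup>2 / 160 * (1 / (real p - real r)) \<le> m r" if r: "r < p - 2880" for r
  proof -
    define t where "t = real T * \<theta> - real r"
    have "r + 2881 \<le> p" using r by simp
    then have "real r + 2881 \<le> real p" using of_nat_mono by fastforce
    then have t: "2880 \<le> t" "t \<le> real p - real r" using p1 by (auto simp: t_def)
    have x: "real T * (\<theta> - real r / real T) = t" using T by (simp add: t_def algebra_simps)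
    have "real T * (\<theta> - real r / real T) > 0" unfolding x using t by simp
    then have xpos: "0 < \<theta> - real r / real T" using T by (simp add: zero_less_mult_iff)
    have "\<theta> - real r / real T \<le> \<theta>" by simp
    then have x1: "\<theta> - real r / real T \<le> 1" using \<theta>1 by linarith
    have "\<epsilon>\<^sup>2 * (1 / (80 * t) - 18 / t\<^sup>2) \<le> m r"
      unfolding m_def using twist_ge[OF T xpos x1, of \<epsilon>] unfolding x .
    \<comment> \<open>Here 2880 = 18 * 160: from this distance to resonance on, the error term takes
      at most half of the main term. The nearer blocks are left out of the count.\<close>
    moreover have "1 / (160 * t) \<le> 1 / (80 * t) - 18 / t\<^sup>2"
      using t by (simp add: field_simps power2_eq_square)
    then have "\<epsilon>\<^sup>2 * (1 / (160 * t)) \<le> \<epsilon>\<^sup>2 * (1 / (80 * t) - 18 / t\<^sup>2)" by (intro mult_left_mono) auto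
    moreover have "\<epsilon>\<^sup>2 * (1 / (160 * (real p - real r))) \<le> \<epsilon>\<^sup>2 * (1 / (160 * t))"
      using t by (intro mult_left_mono frac_le) auto
    ultimately show ?thesis by simp
  qed
  have harm_sum: "(\<Sum>r<n. 1 / (real p - real r)) = harm p - (harm (p - n) :: real)" if "n \<le> p" for n
    using that
  proof (induction n)
    case (Suc n)
    then have "p - n = Suc (p - Suc n)" by simp
    then have "harm (p - n) = harm (p - Suc n) + (inverse (of_nat (Suc (p - Suc n))) :: real)"
      by (simp only: harm_Suc)
    moreover have "real (Suc (p - Suc n)) = real p - real n" using Suc.prems by (simp add: of_nat_diff)
    ultimately show ?case using Suc by (simp add: inverse_eq_divide)
  qed simp
  have "1 \<le> \<epsilon>\<^sup>2 / 160 * (harm p - harm 2880)"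
    using harmp \<epsilon> by (simp add: field_simps)
  also have "\<dots> = (\<Sum>r<p - 2880. \<epsilon>\<^sup>2 / 160 * (1 / (real p - real r)))"
    unfolding sum_distrib_left[symmetric] using harm_sum[of "p - 2880"] p3 by simp
  also have "\<dots> \<le> M (p - 2880)" unfolding M_def by (intro sum_mono m_ge) auto
  finally have ex: "1 \<le> M (p - 2880)" .
  \<comment> \<open>Stopping at the first crossing of 1 keeps the angle within [1, 2], because a
    single block turns by at most 1; a later angle might be close to a multiple of 2 pi.\<close>
  define n where "n = (LEAST n. 1 \<le> M n)"
  have n1: "1 \<le> M n" unfolding n_def using ex by (rule LeastI)
  have "n \<le> p - 2880" unfolding n_def using ex by (rule Least_le)
  then have nT: "n \<le> T" using p2 by simp
  have "n \<noteq> 0"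
  proof
    assume "n = 0"
    then show False using n1 by (simp add: M_def)
  qed
  then obtain k where k: "n = Suc k" by (cases n) auto
  then have "\<not> 1 \<le> M k" using not_less_Least[of k "\<lambda>n. 1 \<le> M n"] n_def by simp
  moreover have "\<bar>m k\<bar> \<le> 1" unfolding m_def using block(4)[of k] k nT by simp
  ultimately have n2: "M n \<le> 2" unfolding k by (simp add: M_def)
  have "1 / 3 \<le> cmod (1 - cis (M n))"
    using cmod_one_minus_cis_ge[of "M n"] n1 n2 by simp
  then have "1 / 3 * cmod (u 0) \<le> cmod (1 - cis (M n)) * cmod (u 0)" by (rule mult_right_mono) auto
  also have "\<dots> = cmod (cis (M n) * u 0 - u 0)"
    unfolding norm_mult[symmetric] by (subst norm_minus_commute) (simp add: algebra_simps)
  also have "\<dots> \<le> cmod (u (n * T) - cis (M n) * u 0) + cmod (u (n * T) - u 0)"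
    by (metis norm_minus_commute norm_triangle_ineq diff_add_cancel add_diff_eq)
  also have "\<dots> \<le> 1 / 12 * cmod (u 0) + cmod (u (n * T) - u 0)"
  proof -
    \<comment> \<open>The bound on \<epsilon> uses 312000 = 12 * 26000, so that 1/3 - 1/12 = 1/4
      remains of the chord.\<close>
    have "26000 * \<epsilon> * cmod (u 0) \<le> 1 / 12 * cmod (u 0)" using \<epsilon> by (intro mult_right_mono) auto
    then show ?thesis using stage_rotation[OF nT] by (simp add: M_def m_def)
  qed
  finally have "cmod (u 0) / 4 \<le> cmod (u (n * T) - u 0)" by simp
  moreover have "n * T \<le> T * T" using nT by simp
  ultimately show ?thesis by blast
qed

end

text \<open>The free unimodular \<kappa> makes stages composable: it receives the phase
  \<open>z ^ Suc m\<close> when the stage starts at index \<open>m\<close>, while the exponent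
  \<open>j\<close> stays local.\<close>

definition rotating_stage :: "real \<Rightarrow> nat \<Rightarrow> (nat \<Rightarrow> complex) \<Rightarrow> bool" where
  "rotating_stage \<epsilon> N b \<longleftrightarrow> N > 0 \<and> (\<Sum>j<N. (cmod (b j))\<^sup>2) \<le> \<epsilon>\<^sup>2 \<and> (\<forall>j<N. cmod (b j) < 1) \<and>
     (\<forall>z \<kappa> u. cmod z = 1 \<longrightarrow> cmod \<kappa> = 1 \<longrightarrow>
        (\<forall>j<N. u (Suc j) = u j + b j * z ^ j * \<kappa> * cnj (u j)) \<longrightarrow>
        \<bar>cmod (u N) - cmod (u 0)\<bar> \<le> 26000 * \<epsilon> * cmod (u 0) \<and>
        (\<forall>j\<le>N. cmod (u j) \<le> 6 * cmod (u 0)) \<and>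
        (\<forall>\<theta>\<in>{1/2..1}. z = cis \<theta> \<longrightarrow> (\<exists>j\<le>N. cmod (u 0) / 4 \<le> cmod (u j - u 0))))"

lemma rotating_stage_exists:
  fixes \<epsilon> :: real
  assumes \<epsilon>: "0 < \<epsilon>" "\<epsilon> \<le> 1/312000"
  shows "\<exists>N b. rotating_stage \<epsilon> N b"
proof -
  have "eventually (\<lambda>n. 160 / \<epsilon>\<^sup>2 + harm 2880 \<le> (harm n :: real) \<and> 1 \<le> n) sequentially"
    using harm_at_top[unfolded filterlim_at_top] eventually_ge_at_top[of 1] by (auto intro: eventually_conj)
  then obtain T0 where T0: "160 / \<epsilon>\<^sup>2 + harm 2880 \<le> (harm T0 :: real)" "1 \<le> T0"
    using eventually_happens[of _ sequentially] by auto
  define T where "T = 2 * T0"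
  have T: "T \<ge> 2" using T0 by (simp add: T_def)
  have cb: "cmod (stage_coeff \<epsilon> T j) \<le> \<epsilon> / real T" for j
    by (rule cmod_stage_coeff_le) (use T \<epsilon> in auto)
  have "rotating_stage \<epsilon> (T * T) (stage_coeff \<epsilon> T)"
    unfolding rotating_stage_def
  proof (intro conjI allI impI ballI)
    show "T * T > 0" using T by simp
    have "(\<Sum>j<T * T. (cmod (stage_coeff \<epsilon> T j))\<^sup>2) \<le> (\<Sum>j<T * T. (\<epsilon> / real T)\<^sup>2)"
      by (intro sum_mono power_mono cb) auto
    also have "\<dots> = \<epsilon>\<^sup>2" using T by (simp add: power2_eq_square)
    finally show "(\<Sum>j<T * T. (cmod (stage_coeff \<epsilon> T j))\<^sup>2) \<le> \<epsilon>\<^sup>2" .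
    have "\<epsilon> / real T < 1" using T \<epsilon> by (simp add: field_simps)
    then show "cmod (stage_coeff \<epsilon> T j) < 1" for j using cb[of j] by simp
  next
    fix z \<kappa> u
    assume z: "cmod z = 1" and k: "cmod \<kappa> = 1"
      and rec: "\<forall>j<T * T. u (Suc j) = u j + stage_coeff \<epsilon> T j * z ^ j * \<kappa> * cnj (u j)"
    \<comment> \<open>The representative of the argument is taken within pi of 1/2, the centre of
      the frequency range, so that no detuning comes near a nonzero multiple of 2 pi.\<close>
    define \<phi> where "\<phi> = Arg (z * cis (- (1/2)))"
    have n: "cmod (z * cis (- (1/2))) = 1" using z by (simp add: norm_mult)
    then have "z * cis (- (1/2)) \<noteq> 0" by (metis norm_zero zero_neq_one)
    then have "cis \<phi> = z * cis (- (1/2))"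
      unfolding \<phi>_def by (metis cis_Arg n sgn_div_norm inverse_1 scaleR_one)
    then have "cis \<phi> * cis (1/2) = z" by (simp only: mult.assoc cis_mult) simp
    then have zc: "z = cis (\<phi> + 1/2)" by (simp add: cis_mult)
    have "\<bar>\<phi> + 1/2 - 1/2\<bar> \<le> pi" using Arg_bounded[of "z * cis (- (1/2))"] by (auto simp: \<phi>_def)
    note A = T \<epsilon> k this rec[unfolded zc, rule_format]
    show "\<bar>cmod (u (T * T)) - cmod (u 0)\<bar> \<le> 26000 * \<epsilon> * cmod (u 0)" by (rule stage_norm_end[OF A])
    show "cmod (u j) \<le> 6 * cmod (u 0)" if "j \<le> T * T" for j by (rule stage_norm_le[OF A that])
    fix \<theta> assume t: "\<theta> \<in> {1/2..1::real}" and zt: "z = cis \<theta>"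
    have "\<bar>\<theta> - 1/2\<bar> \<le> pi" using t pi_gt3 by auto
    then show "\<exists>j\<le>T * T. cmod (u 0) / 4 \<le> cmod (u j - u 0)"
      using stage_moves[OF T \<epsilon> k _ rec[unfolded zt, rule_format] _ _ T_def T0(1)] t by simp
  qed
  then show ?thesis by blast
qed

subsection \<open>Normalised Lebesgue measure on the circle\<close>

lemma measurable_poly [measurable]: "poly (p :: complex poly) \<in> borel_measurable borel"
  by (intro borel_measurable_continuous_onI continuous_intros)

lemma measurable_cnj [measurable]: "cnj \<in> borel_measurable borel"
  by (intro borel_measurable_continuous_onI continuous_intros)

lemma measurable_cis [measurable]: "cis \<in> borel_measurable borel"
  by (intro borel_measurable_continuous_onI continuous_intros)

lemma sets_circle_lebesgue [measurable_cong, simp]: "sets circle_lebesgue = sets borel"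
  by (simp add: circle_lebesgue_def)

lemma space_circle_lebesgue [simp]: "space circle_lebesgue = UNIV"
  by (simp add: circle_lebesgue_def)

lemma borel_circleT [measurable]: "circleT \<in> sets borel"
  by (simp add: circleT_def)

lemma emeasure_circle_lebesgue:
  assumes [measurable]: "A \<in> sets borel"
  shows "emeasure circle_lebesgue A
      = (\<integral>\<^sup>+t. ennreal (indicator {0..2*pi} t / (2*pi)) * indicator A (cis t) \<partial>lborel)"
proof -
  have "emeasure circle_lebesgue A
      = emeasure (density lborel (\<lambda>t. ennreal (indicator {0..2*pi} t / (2*pi)))) (cis -` A)"
    unfolding circle_lebesgue_def by (subst emeasure_distr) auto
  also have "cis -` A \<in> sets borel" using measurable_sets_borel[OF measurable_cis, of A] by simp
  then have "emeasure (density lborel (\<lambda>t. ennreal (indicator {0..2*pi} t / (2*pi)))) (cis -` A)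
      = (\<integral>\<^sup>+t. ennreal (indicator {0..2*pi} t / (2*pi)) * indicator (cis -` A) t \<partial>lborel)"
    by (subst emeasure_density) auto
  finally show ?thesis by (simp add: indicator_vimage)
qed

lemma prob_space_circle_lebesgue: "prob_space circle_lebesgue"
proof
  have "emeasure circle_lebesgue UNIV = (\<integral>\<^sup>+t. ennreal (1 / (2*pi)) * indicator {0..2*pi} t \<partial>lborel)"
    by (subst emeasure_circle_lebesgue) (auto intro!: nn_integral_cong split: split_indicator)
  also have "\<dots> = ennreal (1 / (2*pi)) * ennreal (2 * pi)"
    by (subst nn_integral_cmult_indicator) auto
  also have "\<dots> = 1" by (subst ennreal_mult[symmetric]) auto
  finally show "emeasure circle_lebesgue (space circle_lebesgue) = 1" by simp
qed

interpretation circle: prob_space circle_lebesgue by (rule prob_space_circle_lebesgue)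

lemma circle_lebesgue_outside: "emeasure circle_lebesgue (UNIV - circleT) = 0"
  by (subst emeasure_circle_lebesgue) (auto simp: circleT_def)

lemma AE_circleT: "AE z in circle_lebesgue. z \<in> circleT"
  by (rule AE_I[where N = "UNIV - circleT"]) (use circle_lebesgue_outside in auto)

lemma integrable_circle_continuous:
  fixes f :: "complex \<Rightarrow> 'b::{banach, second_countable_topology}"
  assumes [measurable]: "f \<in> borel_measurable borel" and "continuous_on circleT f"
  shows "integrable circle_lebesgue f"
proof -
  have "compact (f ` circleT)" using assms(2) by (intro compact_continuous_image) (auto simp: circleT_def)
  then obtain B where "\<forall>y\<in>f ` circleT. norm y \<le> B" using compact_imp_bounded bounded_iff by blast
  then have "AE z in circle_lebesgue. norm (f z) \<le> B" using AE_circleT by auto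
  then show ?thesis by (rule circle.integrable_const_bound) simp
qed

text \<open>The factor \<open>z\<close> is the tangent \<open>dz / (\<i> dt)\<close> of the circle,
  so the integral is, up to a constant, a closed contour integral of \<open>f\<close>.\<close>

lemma integral_circle_Cauchy:
  assumes hol: "f holomorphic_on cball 0 1" and [measurable]: "f \<in> borel_measurable borel"
  shows "(\<integral>z. z * f z \<partial>circle_lebesgue) = 0"
proof -
  define g where "g = (\<lambda>t. cis t * f (cis t))"
  have "(f has_contour_integral 0) (part_circlepath 0 1 0 (2 * pi))"
    by (rule Cauchy_theorem_convex_simple[OF hol])
       (use path_image_part_circlepath_subset'[of 1 0 0 "2*pi"] in \<open>auto simp: exp_eq_polar\<close>)
  then have "((\<lambda>t. \<i> * g t) has_integral 0) {0..2*pi}"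
    by (subst (asm) has_contour_integral_part_circlepath_iff) (auto simp: g_def mult_ac)
  then have "((\<lambda>t. (- \<i>) * (\<i> * g t)) has_integral (- \<i>) * 0) {0..2*pi}"
    by (rule has_integral_mult_right)
  then have gi: "(g has_integral 0) {0..2*pi}" by (simp add: mult.assoc[symmetric])
  have "continuous_on {0..2*pi} g"
    unfolding g_def
    by (intro continuous_intros continuous_on_compose2[OF holomorphic_on_imp_continuous_on[OF hol]]) auto
  then have "set_integrable lborel {0..2*pi} g"
    by (rule borel_integrable_atLeastAtMost')
  then have g0: "(LINT t:{0..2*pi}|lborel. g t) = 0"
    using set_borel_integral_eq_integral(2) gi integral_unique by metis
  have "(\<integral>z. z * f z \<partial>circle_lebesgue)
      = (\<integral>t. (indicator {0..2*pi} t / (2*pi)) *\<^sub>R g t \<partial>lborel)"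
    unfolding circle_lebesgue_def
    by (subst integral_distr, simp, simp, subst integral_density) (auto simp: g_def)
  also have "\<dots> = (\<integral>t. (1 / (2*pi)) *\<^sub>R (indicator {0..2*pi} t *\<^sub>R g t) \<partial>lborel)"
    by (intro Bochner_Integration.integral_cong) auto
  also have "\<dots> = (1 / (2*pi)) *\<^sub>R (LINT t:{0..2*pi}|lborel. g t)"
    unfolding set_lebesgue_integral_def by (rule integral_scaleR_right)
  finally show ?thesis unfolding g0 by simp
qed

subsection \<open>Szego recursion\<close>

text \<open>Monic orthogonal polynomials and their reversals; the parameters \<open>b n\<close> are the negatives of the usual
  Verblunsky coefficients.\<close>
primrec szego_pair :: "(nat \<Rightarrow> complex) \<Rightarrow> nat \<Rightarrow> complex poly \<times> complex poly" where
  "szego_pair b 0 = (1, 1)"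
| "szego_pair b (Suc n) = (case szego_pair b n of (p, q) \<Rightarrow>
     (pCons 0 p + smult (cnj (b n)) q, q + smult (b n) (pCons 0 p)))"

definition Phi :: "(nat \<Rightarrow> complex) \<Rightarrow> nat \<Rightarrow> complex poly" where "Phi b n = fst (szego_pair b n)"
definition Psi :: "(nat \<Rightarrow> complex) \<Rightarrow> nat \<Rightarrow> complex poly" where "Psi b n = snd (szego_pair b n)"

lemma Phi_0 [simp]: "Phi b 0 = 1" and Psi_0 [simp]: "Psi b 0 = 1"
  and Phi_Suc: "Phi b (Suc n) = pCons 0 (Phi b n) + smult (cnj (b n)) (Psi b n)"
  and Psi_Suc: "Psi b (Suc n) = Psi b n + smult (b n) (pCons 0 (Phi b n))"
  by (simp_all add: Phi_def Psi_def split: prod.splits)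

lemma degree_Psi_le: "degree (Psi b n) \<le> n" and degree_Phi_le: "degree (Phi b n) \<le> n"
proof (induction n)
  case (Suc n)
  { case 1 then show ?case unfolding Psi_Suc using Suc
      by (intro degree_add_le degree_smult_le[THEN order_trans] degree_pCons_le[THEN order_trans]) auto }
  { case 2 then show ?case unfolding Phi_Suc using Suc
      by (intro degree_add_le degree_smult_le[THEN order_trans] degree_pCons_le[THEN order_trans]) auto }
qed auto

lemma coeff_Phi_top: "coeff (Phi b n) n = 1"
proof (induction n)
  case (Suc n)
  have "coeff (Psi b n) (Suc n) = 0" using degree_Psi_le[of b n] by (intro coeff_eq_0) auto
  then show ?case using Suc by (simp add: Phi_Suc)
qed simp

lemma degree_Phi: "degree (Phi b n) = n"
  using degree_Phi_le[of b n] coeff_Phi_top[of b n] by (intro antisym le_degree) auto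

lemma Phi_on_circle:
  assumes "cmod z = 1"
  shows "poly (Phi b n) z = z ^ n * cnj (poly (Psi b n) z)"
proof (induction n)
  case (Suc n)
  have z: "z * cnj z = 1" using assms by (metis complex_norm_square of_real_1 power_one)
  have "z ^ Suc n * cnj z ^ Suc n = 1" by (metis z power_mult_distrib power_one)
  then have "z ^ Suc n * (cnj (b n) * (cnj z ^ Suc n * poly (Psi b n) z)) = cnj (b n) * poly (Psi b n) z"
    by (simp add: mult_ac)
  moreover have "poly (Phi b (Suc n)) z = z ^ Suc n * cnj (poly (Psi b n) z) + cnj (b n) * poly (Psi b n) z"
    by (simp add: Phi_Suc Suc)
  moreover have "cnj (poly (Psi b (Suc n)) z) = cnj (poly (Psi b n) z) + cnj (b n) * (cnj z ^ Suc n * poly (Psi b n) z)"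
    by (simp add: Psi_Suc Suc)
  ultimately show ?case by (simp add: distrib_left del: power_Suc)
qed simp

lemma Psi_Suc_on_circle:
  assumes "cmod z = 1"
  shows "poly (Psi b (Suc n)) z = poly (Psi b n) z + b n * z ^ Suc n * cnj (poly (Psi b n) z)"
  by (simp add: Psi_Suc Phi_on_circle[OF assms] mult_ac)

text \<open>The quotient \<open>Phi / Psi\<close> is holomorphic in the disc by induction and
  unimodular on the circle, so the maximum principle gives |Phi| at most |Psi| inside. As
  \<open>cmod (b n) < 1\<close>, the term added by the recursion cannot cancel
  \<open>Psi\<close>.\<close>

lemma Psi_nonzero:
  assumes b: "\<And>n. cmod (b n) < 1" and "cmod z \<le> 1"
  shows "poly (Psi b n) z \<noteq> 0"
  using assms(2)
proof (induction n arbitrary: z)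
  case (Suc n)
  define f where "f = (\<lambda>z. poly (Phi b n) z / poly (Psi b n) z)"
  have "cmod (f z) \<le> 1"
  proof (rule maximum_modulus_frontier[of f "cball 0 1"])
    show "f holomorphic_on interior (cball 0 1)"
      unfolding f_def using Suc.IH by (intro holomorphic_intros) auto
    show "continuous_on (closure (cball 0 1)) f"
      unfolding f_def using Suc.IH by (intro continuous_intros) auto
    show "cmod (f z) \<le> 1" if "z \<in> frontier (cball 0 1)" for z
      using that Suc.IH[of z] by (simp add: f_def norm_divide Phi_on_circle norm_mult norm_power)
  qed (use Suc.prems in auto)
  then have "cmod (poly (Phi b n) z) \<le> cmod (poly (Psi b n) z)"
    using Suc.IH[OF Suc.prems] by (simp add: f_def norm_divide)
  then have "cmod z * cmod (poly (Phi b n) z) \<le> 1 * cmod (poly (Psi b n) z)"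
    using Suc.prems by (intro mult_mono) auto
  then have "cmod (b n) * (cmod z * cmod (poly (Phi b n) z)) \<le> cmod (b n) * cmod (poly (Psi b n) z)"
    by (intro mult_left_mono) auto
  also have "\<dots> < 1 * cmod (poly (Psi b n) z)"
    using b[of n] Suc.IH[OF Suc.prems] by (intro mult_strict_right_mono) auto
  finally have "cmod (b n * (z * poly (Phi b n) z)) < cmod (poly (Psi b n) z)" by (simp add: norm_mult)
  then have "poly (Psi b n) z + b n * (z * poly (Phi b n) z) \<noteq> 0"
    by (metis add_eq_0_iff2 less_irrefl norm_minus_cancel)
  then show ?case by (simp add: Psi_Suc mult_ac)
qed simp

text \<open>For \<open>m = n\<close> this is Cauchy's theorem; inverting the recursion passes from \<open>m + 1\<close> to \<open>m\<close>.\<close>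
lemma Bernstein_Szego_moments:
  fixes b :: "nat \<Rightarrow> complex" and n :: nat
  defines "W \<equiv> \<lambda>z. complex_of_real (1 / (cmod (poly (Psi b n) z))\<^sup>2)"
  assumes b: "\<And>n. cmod (b n) < 1" and "m \<le> n"
  shows "(\<forall>j<m. (\<integral>z. poly (Phi b m) z * cnj z ^ j * W z \<partial>circle_lebesgue) = 0) \<and>
    (\<forall>j. 1 \<le> j \<and> j \<le> m \<longrightarrow> (\<integral>z. poly (Psi b m) z * cnj z ^ j * W z \<partial>circle_lebesgue) = 0)"
  using \<open>m \<le> n\<close>
proof (induction m rule: inc_induct)
  case base
  have nz: "poly (Psi b n) z \<noteq> 0" if "cmod z \<le> 1" for z using Psi_nonzero[OF b that] .
  have C: "(\<integral>z. z * (z ^ i / poly (Psi b n) z) \<partial>circle_lebesgue) = 0" for i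
    by (rule integral_circle_Cauchy) (use nz in \<open>auto intro!: holomorphic_intros\<close>)
  have Wz: "W z = 1 / (poly (Psi b n) z * cnj (poly (Psi b n) z))" for z
    unfolding W_def by (simp only: of_real_divide of_real_1 complex_norm_square)
  \<comment> \<open>On the circle the integrand is \<open>z ^ (n - j) / Psi\<close>;
    \<open>j < n\<close> supplies the factor \<open>z\<close> for Cauchy's theorem.\<close>
  have 1: "(\<integral>z. poly (Phi b n) z * cnj z ^ j * W z \<partial>circle_lebesgue) = 0" if j: "j < n" for j
  proof -
    have "(\<integral>z. poly (Phi b n) z * cnj z ^ j * W z \<partial>circle_lebesgue)
       = (\<integral>z. z * (z ^ (n - Suc j) / poly (Psi b n) z) \<partial>circle_lebesgue)"
    proof (rule integral_cong_AE)
      show "AE z in circle_lebesgue. poly (Phi b n) z * cnj z ^ j * W z = z * (z ^ (n - Suc j) / poly (Psi b n) z)"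
        using AE_circleT
      proof eventually_elim
        case (elim z)
        then have z1: "cmod z = 1" by (simp add: circleT_def)
        then have "z * cnj z = 1" by (metis complex_norm_square of_real_1 power_one)
        then have zz: "z ^ j * cnj z ^ j = 1" by (metis power_mult_distrib power_one)
        have "z ^ n = z ^ j * (z * z ^ (n - Suc j))"
          using j by (metis Suc_diff_Suc add_diff_inverse_nat nat_diff_split not_less_iff_gr_or_eq power_Suc power_add)
        then have "z ^ n * cnj z ^ j = z * z ^ (n - Suc j)" using zz by (simp add: mult_ac)
        then have "poly (Phi b n) z * cnj z ^ j = z * z ^ (n - Suc j) * cnj (poly (Psi b n) z)"
          unfolding Phi_on_circle[OF z1] by (simp add: mult_ac)
        then show ?case using nz[of z] z1 unfolding Wz by simp
      qed
    qed (auto simp: W_def)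
    then show ?thesis using C by simp
  qed
  \<comment> \<open>Here the integrand is the conjugate of \<open>z ^ j / Psi\<close>, so Cauchy's
    theorem applies after conjugation.\<close>
  have 2: "(\<integral>z. poly (Psi b n) z * cnj z ^ j * W z \<partial>circle_lebesgue) = 0" if j: "1 \<le> j" for j
  proof -
    have "(\<integral>z. poly (Psi b n) z * cnj z ^ j * W z \<partial>circle_lebesgue)
       = (\<integral>z. cnj (z * (z ^ (j - 1) / poly (Psi b n) z)) \<partial>circle_lebesgue)"
    proof (rule integral_cong_AE)
      show "AE z in circle_lebesgue. poly (Psi b n) z * cnj z ^ j * W z = cnj (z * (z ^ (j - 1) / poly (Psi b n) z))"
        using AE_circleT
      proof eventually_elim
        case (elim z)
        then have "poly (Psi b n) z \<noteq> 0" using nz[of z] by (simp add: circleT_def)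
        moreover have "cnj z ^ j = cnj z * cnj z ^ (j - 1)" using j by (cases j) auto
        ultimately show ?case unfolding Wz by simp
      qed
    qed (auto simp: W_def)
    then show ?thesis using C[of "j - 1"] by (simp only: Bochner_Integration.integral_cnj complex_cnj_zero)
  qed
  show ?case using 1 2 by blast
next
  case (step m)
  \<comment> \<open>The determinant, up to the factor \<open>z\<close>, of the recursion step that
    is inverted in \<open>Phi\<close> and \<open>Psi\<close> below.\<close>
  define c where "c = complex_of_real (1 - (cmod (b m))\<^sup>2)"
  have "(cmod (b m))\<^sup>2 < 1" using b[of m] by (simp add: abs_square_less_1)
  then have c: "c \<noteq> 0" unfolding c_def of_real_eq_0_iff by simp
  have bb: "b m * cnj (b m) = 1 - c" unfolding c_def by (simp only: of_real_diff of_real_1 complex_norm_square) simp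
  have Phi: "c * (z * poly (Phi b m) z) = poly (Phi b (Suc m)) z - cnj (b m) * poly (Psi b (Suc m)) z" for z
  proof -
    have "poly (Phi b (Suc m)) z - cnj (b m) * poly (Psi b (Suc m)) z = (1 - b m * cnj (b m)) * (z * poly (Phi b m) z)"
      by (simp add: Phi_Suc Psi_Suc algebra_simps)
    then show ?thesis by (simp add: bb)
  qed
  have Psi: "c * poly (Psi b m) z = poly (Psi b (Suc m)) z - b m * poly (Phi b (Suc m)) z" for z
  proof -
    have "poly (Psi b (Suc m)) z - b m * poly (Phi b (Suc m)) z = (1 - b m * cnj (b m)) * poly (Psi b m) z"
      by (simp add: Phi_Suc Psi_Suc algebra_simps)
    then show ?thesis by (simp add: bb)
  qed
  have int: "integrable circle_lebesgue (\<lambda>z. poly p z * cnj z ^ j * W z)" for p j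
    by (rule integrable_circle_continuous)
       (use Psi_nonzero[OF b] in \<open>auto simp: W_def circleT_def intro!: continuous_intros\<close>)
  have split: "(\<integral>z. (poly p z - a * poly q z) * cnj z ^ j * W z \<partial>circle_lebesgue)
     = (\<integral>z. poly p z * cnj z ^ j * W z \<partial>circle_lebesgue) - a * (\<integral>z. poly q z * cnj z ^ j * W z \<partial>circle_lebesgue)"
    for p q a j
  proof -
    have "(\<integral>z. (poly p z - a * poly q z) * cnj z ^ j * W z \<partial>circle_lebesgue)
       = (\<integral>z. poly p z * cnj z ^ j * W z - a * (poly q z * cnj z ^ j * W z) \<partial>circle_lebesgue)"
      by (simp add: algebra_simps)
    then show ?thesis using int by simp
  qed
  \<comment> \<open>The inverted recursion yields \<open>z * Phi b m\<close>; on the circle the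
    extra \<open>z\<close> is undone by one more power of \<open>cnj z\<close>. The shift from
    \<open>j\<close> to \<open>Suc j\<close> is why the two index ranges differ.\<close>
  have 1: "(\<integral>z. poly (Phi b m) z * cnj z ^ j * W z \<partial>circle_lebesgue) = 0" if j: "j < m" for j
  proof -
    have "c * (\<integral>z. poly (Phi b m) z * cnj z ^ j * W z \<partial>circle_lebesgue)
       = (\<integral>z. c * (poly (Phi b m) z * cnj z ^ j * W z) \<partial>circle_lebesgue)" by simp
    also have "\<dots> = (\<integral>z. (poly (Phi b (Suc m)) z - cnj (b m) * poly (Psi b (Suc m)) z) * cnj z ^ Suc j * W z \<partial>circle_lebesgue)"
    proof (rule integral_cong_AE)
      show "AE z in circle_lebesgue. c * (poly (Phi b m) z * cnj z ^ j * W z)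
          = (poly (Phi b (Suc m)) z - cnj (b m) * poly (Psi b (Suc m)) z) * cnj z ^ Suc j * W z"
        using AE_circleT
      proof eventually_elim
        case (elim z)
        then have "cmod z = 1" by (simp add: circleT_def)
        then have "z * cnj z = 1" by (metis complex_norm_square of_real_1 power_one)
        then have "c * (z * poly (Phi b m) z) * cnj z ^ Suc j * W z = c * (poly (Phi b m) z * cnj z ^ j * W z)"
          by (simp add: mult_ac)
        then show ?case unfolding Phi by (rule sym)
      qed
    qed (auto simp: W_def)
    also have "\<dots> = 0" unfolding split using step.IH j by (simp del: power_Suc)
    finally show ?thesis using c by simp
  qed
  have 2: "(\<integral>z. poly (Psi b m) z * cnj z ^ j * W z \<partial>circle_lebesgue) = 0" if j: "1 \<le> j" "j \<le> m" for j
  proof -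
    have "c * (\<integral>z. poly (Psi b m) z * cnj z ^ j * W z \<partial>circle_lebesgue)
       = (\<integral>z. c * (poly (Psi b m) z * cnj z ^ j * W z) \<partial>circle_lebesgue)" by simp
    also have "\<dots> = (\<integral>z. (c * poly (Psi b m) z) * cnj z ^ j * W z \<partial>circle_lebesgue)"
      by (simp only: mult.assoc)
    also have "\<dots> = 0" unfolding Psi split using step.IH j by simp
    finally show ?thesis using c by simp
  qed
  show ?case using 1 2 by blast
qed

text \<open>Expanding the polynomial of lower degree reduces this to the moments; the other case
  follows by conjugation because the weight is real. All weights of large index share these
  orthogonality relations, so they survive a limit of the weights.\<close>

lemma Bernstein_Szego_orthogonal:
  fixes b :: "nat \<Rightarrow> complex"
  assumes b: "\<And>n. cmod (b n) < 1" and "m \<le> n" "l \<le> n" "m \<noteq> l"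
  shows "(\<integral>z. poly (Phi b m) z * cnj (poly (Phi b l) z) * of_real (1 / (cmod (poly (Psi b n) z))\<^sup>2) \<partial>circle_lebesgue) = 0"
proof -
  define W where "W = (\<lambda>z. complex_of_real (1 / (cmod (poly (Psi b n) z))\<^sup>2))"
  have less: "(\<integral>z. poly (Phi b m) z * cnj (poly (Phi b l) z) * W z \<partial>circle_lebesgue) = 0"
    if "l < m" "m \<le> n" for l m
  proof -
    have int: "integrable circle_lebesgue (\<lambda>z. poly (Phi b m) z * cnj z ^ i * W z)" for i
      by (rule integrable_circle_continuous)
         (use Psi_nonzero[OF b] in \<open>auto simp: W_def circleT_def intro!: continuous_intros\<close>)
    have "(\<integral>z. poly (Phi b m) z * cnj (poly (Phi b l) z) * W z \<partial>circle_lebesgue)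
       = (\<integral>z. (\<Sum>i\<le>l. cnj (coeff (Phi b l) i) * (poly (Phi b m) z * cnj z ^ i * W z)) \<partial>circle_lebesgue)"
      by (intro Bochner_Integration.integral_cong refl)
         (simp add: poly_altdef[of "Phi b l"] degree_Phi sum_distrib_left sum_distrib_right mult_ac)
    also have "\<dots> = (\<Sum>i\<le>l. cnj (coeff (Phi b l) i) * (\<integral>z. poly (Phi b m) z * cnj z ^ i * W z \<partial>circle_lebesgue))"
      using int by (subst Bochner_Integration.integral_sum) auto
    also have "\<dots> = 0"
      using Bernstein_Szego_moments[OF b \<open>m \<le> n\<close>] \<open>l < m\<close> unfolding W_def by (intro sum.neutral) auto
    finally show ?thesis .
  qed
  show ?thesis
  proof (cases "l < m")
    case True
    then show ?thesis using less[of l m] assms by (simp add: W_def)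
  next
    case False
    then have "(\<integral>z. poly (Phi b l) z * cnj (poly (Phi b m) z) * W z \<partial>circle_lebesgue) = 0"
      using less[of m l] assms by simp
    then have "(\<integral>z. cnj (poly (Phi b l) z * cnj (poly (Phi b m) z) * W z) \<partial>circle_lebesgue) = 0"
      by (simp only: Bochner_Integration.integral_cnj complex_cnj_zero)
    then show ?thesis by (simp add: W_def mult_ac)
  qed
qed

subsection \<open>Concatenation of the stages\<close>

lemma sum_lessThan_add:
  fixes f :: "nat \<Rightarrow> 'a::comm_monoid_add"
  shows "sum f {..<m + n} = sum f {..<m} + (\<Sum>j<n. f (m + j))"
  by (induction n) (auto simp: algebra_simps)

text \<open>The interval [1/2, 1] and its translates by k/2 abut, so they sweep the half-line and,
  wrapped around the circle, meet each point infinitely often.\<close>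

lemma cis_shift_into_interval:
  assumes "cmod z = 1"
  obtains k :: nat and \<theta> :: real where "k \<ge> K" "\<theta> \<in> {1/2..1}" "z * cis (- (real k / 2)) = cis \<theta>"
proof -
  obtain t where t: "-pi < t" "t \<le> pi" "z = cis t"
    using assms by (metis Arg_bounded cis_Arg norm_zero sgn_div_norm inverse_1 scaleR_one zero_neq_one)
  \<comment> \<open>Twice an argument of \<open>z\<close>, lifted by \<open>Suc K\<close> full turns
    to force \<open>k\<close> beyond \<open>K\<close>.\<close>
  define y where "y = 2 * (t + 2 * pi * real (Suc K))"
  define k where "k = nat (\<lfloor>y\<rfloor> - 1)"
  have "y \<ge> 2 * (- pi + 2 * pi * real (Suc K))" using t by (simp add: y_def)
  also have "2 * (- pi + 2 * pi * real (Suc K)) = 2 * pi + 4 * (pi * real K)" by (simp add: algebra_simps)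
  finally have "y \<ge> 2 * pi + 4 * (pi * real K)" .
  moreover have "3 * real K \<le> pi * real K" using pi_gt3 by (intro mult_right_mono) auto
  ultimately have y: "y \<ge> real K + 2" using pi_gt3 by linarith
  have k1: "real k = of_int \<lfloor>y\<rfloor> - 1" unfolding k_def using y by linarith
  show thesis
  proof (rule that[of k "y / 2 - real k / 2"])
    have "of_int \<lfloor>y\<rfloor> \<ge> real K + 1" using y by linarith
    then show "k \<ge> K" using k1 by linarith
    show "y / 2 - real k / 2 \<in> {1/2..1}" unfolding atLeastAtMost_iff using k1 by linarith
    have "y / 2 - real k / 2 = t + - (real k / 2) + 2 * pi * real (Suc K)" by (simp add: y_def)
    then have "cis (y / 2 - real k / 2) = cis (t + - (real k / 2)) * cis (2 * pi * real (Suc K))"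
      by (simp only: cis_mult)
    also have "cis (2 * pi * real (Suc K)) = 1" by (rule cis_multiple_2pi) simp
    finally show "z * cis (- (real k / 2)) = cis (y / 2 - real k / 2)" by (simp add: t cis_mult)
  qed
qed

lemma diverging_coefficients:
  obtains b :: "nat \<Rightarrow> complex" and off :: "nat \<Rightarrow> nat"
  where "\<And>n. cmod (b n) < 1" "summable (\<lambda>n. (cmod (b n))\<^sup>2)" "\<And>k. k \<le> off k"
    "\<And>n z. cmod z = 1 \<Longrightarrow> cmod (poly (Psi b n) z) \<le> 12"
    "\<And>k z. cmod z = 1 \<Longrightarrow> 1/2 \<le> cmod (poly (Psi b (off k)) z)"
    "\<And>k z. cmod z = 1 \<Longrightarrow> cmod (poly (Psi b (off k)) z) \<le> 2"
    "\<And>z. cmod z = 1 \<Longrightarrow> convergent (\<lambda>k. cmod (poly (Psi b (off k)) z))"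
    "\<And>z. cmod z = 1 \<Longrightarrow> \<not> convergent (\<lambda>n. poly (Psi b n) z)"
proof -
  \<comment> \<open>The factor 1/312000 is the smallness a stage requires; the geometric decay makes
    the squared norms and the relative changes of modulus summable.\<close>
  define \<epsilon> where "\<epsilon> = (\<lambda>k. (1/2)^k / 312000 :: real)"
  have \<epsilon>0: "0 < \<epsilon> k" for k by (simp add: \<epsilon>_def)
  have half: "(1/2 :: real) ^ k \<le> 1" for k by (simp add: power_le_one)
  have \<epsilon>1: "\<epsilon> k \<le> 1/312000" for k using half[of k] by (simp add: \<epsilon>_def)
  have "\<exists>N b. rotating_stage (\<epsilon> k) N b" for k by (rule rotating_stage_exists[OF \<epsilon>0 \<epsilon>1])
  then obtain N B where st: "\<And>k. rotating_stage (\<epsilon> k) (N k) (B k)" by metis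
  have N0: "N k > 0" for k using st unfolding rotating_stage_def by blast
  define off where "off = (\<lambda>k. \<Sum>i<k. N i)"
  have OS: "off (Suc k) = off k + N k" for k by (simp add: off_def)
  have O0: "off 0 = 0" by (simp add: off_def)
  have Omono: "off k \<le> off l" if "k \<le> l" for k l unfolding off_def using that by (intro sum_mono2) auto
  have Oge: "k \<le> off k" for k
  proof (induction k)
    case (Suc k)
    then show ?case using N0[of k] by (simp add: OS)
  qed simp
  \<comment> \<open>\<open>GREATEST\<close> finds the stage containing \<open>n\<close>. The powers
    of \<open>cis (- (k / 2))\<close> make stage \<open>k\<close> act at \<open>z\<close> as the
    unrotated stage acts at \<open>z * cis (- (k / 2))\<close>.\<close>
  define b where "b = (\<lambda>n. let k = GREATEST k. off k \<le> n in B k (n - off k) * cis (- (real k / 2)) ^ (n - off k))"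
  have bO: "b (off k + j) = B k j * cis (- (real k / 2)) ^ j" if j: "j < N k" for k j
  proof -
    have "(GREATEST l. off l \<le> off k + j) = k"
    proof (rule Greatest_equality)
      fix l assume l: "off l \<le> off k + j"
      show "l \<le> k"
      proof (rule ccontr)
        assume "\<not> l \<le> k"
        then have "off (Suc k) \<le> off l" by (intro Omono) auto
        then show False using l j by (simp add: OS)
      qed
    qed simp
    then show ?thesis by (simp add: b_def Let_def)
  qed
  have decomp: "\<exists>k j. j < N k \<and> n = off k + j" for n
  proof (induction n)
    case 0
    show ?case using N0[of 0] O0 by (intro exI[of _ 0]) auto
  next
    case (Suc n)
    then obtain k j where kj: "j < N k" "n = off k + j" by blast
    show ?case
    proof (cases "Suc j < N k")
      case True
      then show ?thesis using kj by (intro exI[of _ k] exI[of _ "Suc j"]) auto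
    next
      case False
      then have "Suc n = off (Suc k) + 0" using kj by (simp add: OS)
      then show ?thesis using N0[of "Suc k"] by blast
    qed
  qed
  have nb: "cmod (b (off k + j)) = cmod (B k j)" if "j < N k" for k j
    by (simp add: bO[OF that] norm_mult norm_power)
  have b1: "cmod (b n) < 1" for n
  proof -
    obtain k j where kj: "j < N k" "n = off k + j" using decomp by blast
    then show ?thesis using st[of k] nb[of j k] unfolding rotating_stage_def by simp
  qed
  have sq: "(\<Sum>n<off k. (cmod (b n))\<^sup>2) \<le> 1 - (1/2)^k" for k
  proof (induction k)
    case (Suc k)
    have "(\<Sum>j<N k. (cmod (b (off k + j)))\<^sup>2) = (\<Sum>j<N k. (cmod (B k j))\<^sup>2)"
      by (rule sum.cong) (auto simp: nb)
    also have "\<dots> \<le> (\<epsilon> k)\<^sup>2" using st[of k] unfolding rotating_stage_def by blast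
    also have "\<dots> \<le> \<epsilon> k * 1" unfolding power2_eq_square using \<epsilon>0[of k] \<epsilon>1[of k] by (intro mult_left_mono) auto
    also have "\<dots> \<le> (1/2)^k / 2" by (simp add: \<epsilon>_def)
    finally show ?case using Suc by (simp add: OS sum_lessThan_add)
  qed (simp add: O0)
  have sb: "summable (\<lambda>n. (cmod (b n))\<^sup>2)"
  proof (rule summableI_nonneg_bounded[where x = 1])
    fix n
    have "(\<Sum>i<n. (cmod (b i))\<^sup>2) \<le> (\<Sum>i<off n. (cmod (b i))\<^sup>2)" using Oge[of n] by (intro sum_mono2) auto
    also have "\<dots> \<le> 1" using sq[of n] zero_le_power[of "1/2::real" n] by linarith
    finally show "(\<Sum>i<n. (cmod (b i))\<^sup>2) \<le> 1" .
  qed simp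
  define u where "u = (\<lambda>z n. poly (Psi b n) z)"
  have stage: "\<bar>cmod (u z (off (Suc k))) - cmod (u z (off k))\<bar> \<le> (1/2)^k / 4 * cmod (u z (off k)) \<and>
      (\<forall>j\<le>N k. cmod (u z (off k + j)) \<le> 6 * cmod (u z (off k))) \<and>
      (\<forall>\<theta>\<in>{1/2..1}. z * cis (- (real k / 2)) = cis \<theta> \<longrightarrow>
        (\<exists>j\<le>N k. cmod (u z (off k)) / 4 \<le> cmod (u z (off k + j) - u z (off k))))"
    if z: "cmod z = 1" for z k
  proof -
    have rec: "\<forall>j<N k. u z (off k + Suc j) = u z (off k + j)
        + B k j * (z * cis (- (real k / 2))) ^ j * z ^ Suc (off k) * cnj (u z (off k + j))"
    proof (intro allI impI)
      fix j assume j: "j < N k"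
      show "u z (off k + Suc j) = u z (off k + j)
        + B k j * (z * cis (- (real k / 2))) ^ j * z ^ Suc (off k) * cnj (u z (off k + j))"
        using Psi_Suc_on_circle[OF z, of b "off k + j"] bO[OF j]
        by (simp add: u_def power_mult_distrib power_add mult_ac)
    qed
    have 1: "cmod (z * cis (- (real k / 2))) = 1" "cmod (z ^ Suc (off k)) = 1"
      using z by (simp_all add: norm_mult norm_power)
    have S: "\<bar>cmod (u z (off k + N k)) - cmod (u z (off k + 0))\<bar> \<le> 26000 * \<epsilon> k * cmod (u z (off k + 0)) \<and>
      (\<forall>j\<le>N k. cmod (u z (off k + j)) \<le> 6 * cmod (u z (off k + 0))) \<and>
      (\<forall>\<theta>\<in>{1/2..1}. z * cis (- (real k / 2)) = cis \<theta> \<longrightarrow>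
        (\<exists>j\<le>N k. cmod (u z (off k + 0)) / 4 \<le> cmod (u z (off k + j) - u z (off k + 0))))"
      using st[of k, unfolded rotating_stage_def, THEN conjunct2, THEN conjunct2, THEN conjunct2,
          rule_format (no_asm), OF 1, of "\<lambda>j. u z (off k + j)"] rec by blast
    have "26000 * \<epsilon> k * cmod (u z (off k)) \<le> (1/2)^k / 4 * cmod (u z (off k))"
      by (intro mult_right_mono) (auto simp: \<epsilon>_def)
    then show ?thesis using S by (simp add: OS)
  qed
  \<comment> \<open>The margins shrink geometrically with \<open>k\<close>, which pays for the
    relative change of at most \<open>(1/2)^k / 4\<close> in stage \<open>k\<close> and keeps the
    modulus between 1/2 and 2.\<close>
  have Vbounds: "1/2 + (1/2)^k / 2 \<le> cmod (u z (off k)) \<and> cmod (u z (off k)) \<le> 2 - (1/2)^k"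
    if z: "cmod z = 1" for z k
  proof (induction k)
    case 0
    show ?case by (simp add: u_def O0)
  next
    case (Suc k)
    define V where "V = cmod (u z (off k))"
    define h where "h = (1/2 :: real)^k"
    have h: "0 < h" "h \<le> 1" using half[of k] by (auto simp: h_def)
    have IH: "1/2 + h / 2 \<le> V" "V \<le> 2 - h" using Suc by (auto simp: V_def h_def)
    have st1: "\<bar>cmod (u z (off (Suc k))) - V\<bar> \<le> h / 4 * V" using stage[OF z, of k] by (simp add: V_def h_def)
    have hh: "h * h \<le> h" "0 \<le> h * h" using h by (auto simp: mult_left_le)
    have "h / 4 * V \<le> h / 4 * (2 - h)" using IH h by (intro mult_left_mono) auto
    also have "\<dots> \<le> h / 2" using hh by (simp add: algebra_simps)
    finally have up: "cmod (u z (off (Suc k))) \<le> 2 - h / 2" using st1 IH by linarith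
    have "(1 - h / 4) * (1/2 + h / 2) \<le> (1 - h / 4) * V" using IH h by (intro mult_left_mono) auto
    then have "1/2 + h / 4 \<le> V - h / 4 * V"
      using hh by (simp add: algebra_simps)
    then have "1/2 + h / 4 \<le> cmod (u z (off (Suc k)))" using st1 by linarith
    then show ?case using up by (simp add: h_def)
  qed
  have V1: "1/2 \<le> cmod (u z (off k))" and V2: "cmod (u z (off k)) \<le> 2" if "cmod z = 1" for z k
    using Vbounds[OF that, of k] zero_le_power[of "1/2::real" k] by (simp_all only: zero_le_divide_1_iff) linarith+
  show thesis
  proof (rule that[of b off])
    show "cmod (poly (Psi b n) z) \<le> 12" if z: "cmod z = 1" for n z
    proof -
      obtain k j where kj: "j < N k" "n = off k + j" using decomp by blast
      then have "cmod (u z n) \<le> 6 * cmod (u z (off k))" using stage[OF z, of k] by auto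
      then show ?thesis using V2[OF z, of k] by (simp add: u_def)
    qed
    show "convergent (\<lambda>k. cmod (poly (Psi b (off k)) z))" if z: "cmod z = 1" for z
    proof -
      have "norm (cmod (u z (off (Suc k))) - cmod (u z (off k))) \<le> (1/2)^k" for k
      proof -
        have "(1/2)^k / 4 * cmod (u z (off k)) \<le> (1/2)^k / 4 * 2"
          using V2[OF z, of k] by (intro mult_left_mono) auto
        also have "\<dots> \<le> (1/2)^k" by simp
        finally show ?thesis using stage[OF z, of k, THEN conjunct1] unfolding real_norm_def by linarith
      qed
      then have "summable (\<lambda>k. cmod (u z (off (Suc k))) - cmod (u z (off k)))"
        by (intro summable_comparison_test'[OF summable_geometric[of "1/2::real"]]) auto
      then have "convergent (\<lambda>n. cmod (u z (off n)) - cmod (u z (off 0)))"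
        unfolding summable_iff_convergent
        using sum_lessThan_telescope[of "\<lambda>k. cmod (u z (off k))"] by simp
      then have "convergent (\<lambda>n. (cmod (u z (off n)) - cmod (u z (off 0))) + cmod (u z (off 0)))"
        by (intro convergent_add convergent_const)
      then show ?thesis by (simp add: u_def)
    qed
    show "\<not> convergent (\<lambda>n. poly (Psi b n) z)" if z: "cmod z = 1" for z
    proof
      assume "convergent (\<lambda>n. poly (Psi b n) z)"
      then have "Cauchy (u z)" unfolding u_def by (rule convergent_Cauchy)
      \<comment> \<open>1/8 is a quarter of the lower bound 1/2 for the modulus, hence a distance
        covered in every stage whose arc contains \<open>z\<close>, and there are such stages beyond
        every index.\<close>
      then obtain M where M: "\<And>m n. m \<ge> M \<Longrightarrow> n \<ge> M \<Longrightarrow> dist (u z m) (u z n) < 1/8"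
        unfolding Cauchy_def by (metis zero_less_divide_1_iff zero_less_numeral)
      obtain k \<theta> where k: "k \<ge> M" "\<theta> \<in> {1/2..1}" "z * cis (- (real k / 2)) = cis \<theta>"
        using cis_shift_into_interval[OF z] by metis
      then obtain j where "cmod (u z (off k)) / 4 \<le> cmod (u z (off k + j) - u z (off k))"
        using stage[OF z, of k] by blast
      then have "1/8 \<le> dist (u z (off k + j)) (u z (off k))"
        using V1[OF z, of k] by (simp add: dist_norm)
      moreover have "off k \<ge> M" using Oge[of k] k by simp
      ultimately show False using M[of "off k + j" "off k"] by simp
    qed
  qed (use b1 sb Oge V1 V2 in \<open>auto simp: u_def\<close>)
qed

subsection \<open>The limiting measure\<close>

lemma emeasure_circle_lebesgue_ball_pos:
  assumes t: "0 < t" "t < 2 * pi" and "e > 0"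
  shows "emeasure circle_lebesgue (ball (cis t) e) > 0"
proof -
  have "continuous_on UNIV cis" by (intro continuous_intros)
  then have "isCont cis t" by (simp add: continuous_on_eq_continuous_at)
  then obtain d where d: "d > 0" "\<And>s. dist s t < d \<Longrightarrow> dist (cis s) (cis t) < e"
    using \<open>e > 0\<close> unfolding continuous_at_eps_delta by metis
  \<comment> \<open>The radius also keeps the parameter interval inside [0, 2 pi], away from the
    seam of the parametrisation.\<close>
  define d' where "d' = min d (min t (2 * pi - t))"
  have d': "d' > 0" "d' \<le> d" "d' \<le> t" "d' \<le> 2 * pi - t" using d t by (auto simp: d'_def)
  have "0 < ennreal (1 / (2*pi)) * ennreal (2 * d')"
    using d' by (simp add: ennreal_zero_less_mult_iff)
  also have "\<dots> = (\<integral>\<^sup>+s. ennreal (1 / (2*pi)) * indicator {t - d'<..<t + d'} s \<partial>lborel)"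
    using d' by (subst nn_integral_cmult_indicator) auto
  also have "\<dots> \<le> (\<integral>\<^sup>+s. ennreal (indicator {0..2*pi} s / (2*pi)) * indicator (ball (cis t) e) (cis s) \<partial>lborel)"
  proof (rule nn_integral_mono)
    fix s
    show "ennreal (1 / (2*pi)) * indicator {t - d'<..<t + d'} s
        \<le> ennreal (indicator {0..2*pi} s / (2*pi)) * indicator (ball (cis t) e) (cis s)"
    proof (cases "s \<in> {t - d'<..<t + d'}")
      case True
      then have "dist s t < d" using d' by (auto simp: dist_real_def)
      then have "cis s \<in> ball (cis t) e" using d(2) by (simp add: dist_commute)
      moreover have "s \<in> {0..2*pi}" using True d' by auto
      ultimately show ?thesis using True by simp
    qed simp
  qed
  also have "\<dots> = emeasure circle_lebesgue (ball (cis t) e)"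
    by (subst emeasure_circle_lebesgue) auto
  finally show ?thesis .
qed

lemma infinite_measure_support_density:
  assumes [measurable]: "w \<in> borel_measurable borel" and "c > 0" and w: "\<And>z. c \<le> w z"
  shows "infinite (measure_support (density circle_lebesgue (\<lambda>z. ennreal (w z))))"
proof -
  have "cis t \<in> measure_support (density circle_lebesgue (\<lambda>z. ennreal (w z)))" if "t \<in> {0<..<pi}" for t
    unfolding measure_support_def
  proof (intro CollectI allI impI)
    fix e :: real assume e: "e > 0"
    have "0 < ennreal c * emeasure circle_lebesgue (ball (cis t) e)"
      using emeasure_circle_lebesgue_ball_pos[of t e] that e \<open>c > 0\<close> by (auto simp: ennreal_zero_less_mult_iff)
    also have "\<dots> = (\<integral>\<^sup>+z. ennreal c * indicator (ball (cis t) e) z \<partial>circle_lebesgue)"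
      by (subst nn_integral_cmult_indicator) auto
    also have "\<dots> \<le> (\<integral>\<^sup>+z. ennreal (w z) * indicator (ball (cis t) e) z \<partial>circle_lebesgue)"
      using w by (intro nn_integral_mono mult_right_mono ennreal_leI) auto
    also have "\<dots> = emeasure (density circle_lebesgue (\<lambda>z. ennreal (w z))) (ball (cis t) e)"
      by (subst emeasure_density) auto
    finally show "0 < emeasure (density circle_lebesgue (\<lambda>z. ennreal (w z))) (ball (cis t) e)" .
  qed
  then have "cis ` {0<..<pi} \<subseteq> measure_support (density circle_lebesgue (\<lambda>z. ennreal (w z)))" by auto
  moreover have "inj_on cis {0<..<pi}"
  proof (rule inj_onI)
    fix s t assume st: "s \<in> {0<..<pi}" "t \<in> {0<..<pi}" "cis s = cis t"
    then have "cos s = cos t" by (metis cis.sel(1))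
    then show "s = t" using cos_inj_pi[of s t] st by auto
  qed
  then have "infinite (cis ` {0<..<pi})" using finite_imageD infinite_Ioo[OF pi_gt_zero] by blast
  ultimately show ?thesis using finite_subset by blast
qed

lemma szego_class_density:
  assumes [measurable]: "w \<in> borel_measurable borel"
    and "c > 0" and w: "\<And>z. c \<le> w z" "\<And>z. w z \<le> C"
  shows "szego_class (density circle_lebesgue (\<lambda>z. ennreal (w z)))"
proof -
  have pos: "w z > 0" for z using w(1)[of z] \<open>c > 0\<close> by simp
  have "\<bar>ln (w z)\<bar> \<le> \<bar>ln c\<bar> + \<bar>ln C\<bar>" for z
  proof -
    have "ln c \<le> ln (w z)" "ln (w z) \<le> ln C" using w[of z] pos[of z] \<open>c > 0\<close> by (auto intro!: ln_mono)
    then show ?thesis by linarith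
  qed
  then have "integrable circle_lebesgue (\<lambda>z. ln (w z))"
    by (intro circle.integrable_const_bound[where B = "\<bar>ln c\<bar> + \<bar>ln C\<bar>"]) auto
  \<comment> \<open>The measure is absolutely continuous: the singular part is zero and is carried
    by the empty set.\<close>
  then show ?thesis
    unfolding szego_class_def
    by (intro exI[of _ w] exI[of _ "null_measure borel"] exI[of _ "{}"]) (auto simp: pos less_imp_le)
qed

theorem theorem1p3:
  shows "\<exists>(\<sigma> :: complex measure) (\<alpha> :: nat \<Rightarrow> complex) (\<phi> :: nat \<Rightarrow> complex poly).
           prob_measure_on_T \<sigma> \<and> infinite (measure_support \<sigma>) \<and> szego_class \<sigma> \<and>
           orthonormal_polys \<sigma> \<phi> \<and>
           summable (\<lambda>n. (cmod (\<alpha> n))\<^sup>2) \<and>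
           (\<forall>z \<in> circleT. \<not> convergent (\<lambda>N. \<Sum>n<N. \<alpha> n * poly (\<phi> n) z))"
proof -
  obtain b :: "nat \<Rightarrow> complex" and off :: "nat \<Rightarrow> nat"
    where b1: "\<And>n. cmod (b n) < 1" and sb: "summable (\<lambda>n. (cmod (b n))\<^sup>2)" and off: "\<And>k. k \<le> off k"
      and P12: "\<And>n z. cmod z = 1 \<Longrightarrow> cmod (poly (Psi b n) z) \<le> 12"
      and V1: "\<And>k z. cmod z = 1 \<Longrightarrow> 1/2 \<le> cmod (poly (Psi b (off k)) z)"
      and V2: "\<And>k z. cmod z = 1 \<Longrightarrow> cmod (poly (Psi b (off k)) z) \<le> 2"
      and conv: "\<And>z. cmod z = 1 \<Longrightarrow> convergent (\<lambda>k. cmod (poly (Psi b (off k)) z))"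
      and div: "\<And>z. cmod z = 1 \<Longrightarrow> \<not> convergent (\<lambda>n. poly (Psi b n) z)"
    by (rule diverging_coefficients) blast
  define V where "V = (\<lambda>k z. cmod (poly (Psi b (off k)) z))"
  have [measurable]: "V k \<in> borel_measurable borel" for k unfolding V_def by measurable
  \<comment> \<open>The value 1 off the circle keeps the two-sided bounds valid at every point of
    the plane, as the density lemmas ask.\<close>
  define w0 where "w0 = (\<lambda>z. if z \<in> circleT then 1 / (lim (\<lambda>k. V k z))\<^sup>2 else 1)"
  have [measurable]: "w0 \<in> borel_measurable borel"
    unfolding w0_def by measurable
  have Vlim: "(\<lambda>k. V k z) \<longlonglongrightarrow> lim (\<lambda>k. V k z)" if "cmod z = 1" for z
    using conv[OF that] by (simp add: convergent_LIMSEQ_iff V_def)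
  have L1: "1/2 \<le> lim (\<lambda>k. V k z)" if "cmod z = 1" for z
    by (rule LIMSEQ_le_const[OF Vlim[OF that]]) (use V1[OF that] in \<open>auto simp: V_def\<close>)
  have L2: "lim (\<lambda>k. V k z) \<le> 2" if "cmod z = 1" for z
    by (rule LIMSEQ_le_const2[OF Vlim[OF that]]) (use V2[OF that] in \<open>auto simp: V_def\<close>)
  have inv_sq: "1/4 \<le> 1 / v\<^sup>2 \<and> 1 / v\<^sup>2 \<le> 4" if "1/2 \<le> v" "v \<le> 2" for v :: real
  proof -
    have "(1/2)\<^sup>2 \<le> v\<^sup>2" "v\<^sup>2 \<le> 2\<^sup>2" using that power_mono[of "1/2" v 2] power_mono[of v 2 2] by auto
    then have "1/4 \<le> v\<^sup>2" "v\<^sup>2 \<le> 4" by (auto simp: power_divide)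
    moreover have "0 < v\<^sup>2" using that by simp
    ultimately show ?thesis by (simp add: divide_simps)
  qed
  have w0b: "1/4 \<le> w0 z \<and> w0 z \<le> 4" for z
    using inv_sq[OF L1 L2] by (auto simp: w0_def circleT_def)
  have w0lim: "(\<lambda>k. 1 / (V k z)\<^sup>2) \<longlonglongrightarrow> w0 z" if "z \<in> circleT" for z
  proof -
    have z: "cmod z = 1" using that by (simp add: circleT_def)
    have "(\<lambda>k. 1 / (V k z)\<^sup>2) \<longlonglongrightarrow> 1 / (lim (\<lambda>k. V k z))\<^sup>2"
      by (intro tendsto_intros Vlim[OF z]) (use L1[OF z] in auto)
    then show ?thesis using that by (simp add: w0_def)
  qed
  have "\<bar>w0 z\<bar> \<le> 4" for z using w0b[of z] by linarith
  then have int_w0: "integrable circle_lebesgue w0"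
    by (intro circle.integrable_const_bound[where B = 4]) auto
  define c where "c = (\<integral>z. w0 z \<partial>circle_lebesgue)"
  have c: "1/4 \<le> c" "c \<le> 4"
    unfolding c_def using circle.integral_ge_const[OF int_w0, of "1/4"]
      circle.integral_le_const[OF int_w0, of 4] w0b by auto
  define w where "w = (\<lambda>z. w0 z / c)"
  have [measurable]: "w \<in> borel_measurable borel" unfolding w_def by measurable
  have w1: "1/16 \<le> w z" and w2: "w z \<le> 16" for z
  proof -
    have "(1/4) / 4 \<le> w0 z / c" using w0b[of z] c by (intro frac_le) auto
    then show "1/16 \<le> w z" by (simp add: w_def)
    have "w0 z / c \<le> 4 / (1/4)" using w0b[of z] c by (intro frac_le) (auto intro: order_trans[of _ "1/4"])
    then show "w z \<le> 16" by (simp add: w_def)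
  qed
  have w_nonneg: "0 \<le> w z" for z using w1[of z] by simp
  define \<sigma> where "\<sigma> = density circle_lebesgue (\<lambda>z. ennreal (w z))"
  have int_w: "integrable circle_lebesgue w" "(\<integral>z. w z \<partial>circle_lebesgue) = 1"
    using int_w0 c by (auto simp: w_def c_def[symmetric])
  have prob: "prob_measure_on_T \<sigma>"
    unfolding prob_measure_on_T_def
  proof (intro conjI)
    show "sets \<sigma> = sets borel" by (simp add: \<sigma>_def)
    have "emeasure \<sigma> (space \<sigma>) = (\<integral>\<^sup>+z. ennreal (w z) \<partial>circle_lebesgue)"
      unfolding \<sigma>_def by (subst emeasure_density) auto
    also have "\<dots> = 1" using nn_integral_eq_integral[OF int_w(1)] w_nonneg int_w(2) by simp
    finally show "prob_space \<sigma>" by (rule prob_spaceI)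
    have "UNIV - circleT \<in> null_sets circle_lebesgue"
      using circle_lebesgue_outside by (auto simp: null_sets_def)
    then show "emeasure \<sigma> (UNIV - circleT) = 0"
      unfolding \<sigma>_def by (subst emeasure_density) (auto simp: nn_integral_null_set null_sets_def)
  qed
  have int_\<sigma>: "(\<integral>z. f z \<partial>\<sigma>) = (\<integral>z. w z *\<^sub>R f z \<partial>circle_lebesgue)"
    if [measurable]: "f \<in> borel_measurable borel" for f :: "complex \<Rightarrow> complex"
    unfolding \<sigma>_def by (rule integral_density) (auto simp: w_nonneg)
  have nPhi: "cmod (poly (Phi b n) z) = cmod (poly (Psi b n) z)" if "cmod z = 1" for n z
    using that by (simp add: Phi_on_circle norm_mult norm_power)
  \<comment> \<open>Orthogonality passes to the limit weight by dominated convergence: along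
    \<open>off\<close> the approximating integrals vanish as soon as \<open>off k\<close> is at
    least both degrees.\<close>
  have orth: "(\<integral>z. w0 z *\<^sub>R (poly (Phi b m) z * cnj (poly (Phi b l) z)) \<partial>circle_lebesgue) = 0" if "m \<noteq> l" for m l
  proof -
    define s where "s = (\<lambda>k z. poly (Phi b m) z * cnj (poly (Phi b l) z) * complex_of_real (1 / (V k z)\<^sup>2))"
    have "(\<lambda>k. \<integral>z. s k z \<partial>circle_lebesgue) \<longlonglongrightarrow>
       (\<integral>z. w0 z *\<^sub>R (poly (Phi b m) z * cnj (poly (Phi b l) z)) \<partial>circle_lebesgue)"
    proof (rule integral_dominated_convergence[where w = "\<lambda>_. 12 * 12 * 4"])
      show "AE z in circle_lebesgue. (\<lambda>k. s k z) \<longlonglongrightarrow> w0 z *\<^sub>R (poly (Phi b m) z * cnj (poly (Phi b l) z))"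
        using AE_circleT
      proof eventually_elim
        case (elim z)
        then have "(\<lambda>k. s k z) \<longlonglongrightarrow> poly (Phi b m) z * cnj (poly (Phi b l) z) * complex_of_real (w0 z)"
          unfolding s_def by (intro tendsto_intros w0lim)
        then show ?case by (simp add: scaleR_conv_of_real mult_ac)
      qed
      show "AE z in circle_lebesgue. norm (s k z) \<le> 12 * 12 * 4" for k
        using AE_circleT
      proof eventually_elim
        case (elim z)
        then have z: "cmod z = 1" by (simp add: circleT_def)
        have "1 / (V k z)\<^sup>2 \<le> 4" using inv_sq V1[OF z] V2[OF z] by (simp add: V_def)
        then show ?case unfolding s_def norm_mult norm_of_real complex_mod_cnj
          using P12[OF z, of m] P12[OF z, of l] nPhi[OF z] by (intro mult_mono) auto
      qed
    qed (auto simp: s_def)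
    moreover have "(\<lambda>k. \<integral>z. s k z \<partial>circle_lebesgue) \<longlonglongrightarrow> 0"
    proof (rule tendsto_eventually)
      show "\<forall>\<^sub>F k in sequentially. (\<integral>z. s k z \<partial>circle_lebesgue) = 0"
        using eventually_ge_at_top[of "max m l"]
      proof eventually_elim
        case (elim k)
        then have "m \<le> off k" "l \<le> off k" using off[of k] by auto
        then show ?case unfolding s_def V_def using Bernstein_Szego_orthogonal[OF b1 _ _ that] by simp
      qed
    qed
    ultimately show ?thesis using LIMSEQ_unique by blast
  qed
  \<comment> \<open>The squared norm of \<open>Phi b n\<close> for \<sigma>. Its uniform bound 2304
    = 16 * 12^2 is what carries square summability from \<open>b\<close> to \<alpha>.\<close>
  define K where "K = (\<lambda>n. \<integral>z. w z * (cmod (poly (Phi b n) z))\<^sup>2 \<partial>circle_lebesgue)"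
  have Kb: "AE z in circle_lebesgue. 0 < w z * (cmod (poly (Phi b n) z))\<^sup>2 \<and> w z * (cmod (poly (Phi b n) z))\<^sup>2 \<le> 2304" for n
    using AE_circleT
  proof eventually_elim
    case (elim z)
    then have z: "cmod z = 1" by (simp add: circleT_def)
    have "w z * (cmod (poly (Phi b n) z))\<^sup>2 \<le> 16 * 12\<^sup>2"
      using w2[of z] w_nonneg[of z] P12[OF z, of n] nPhi[OF z] by (intro mult_mono power_mono) auto
    moreover have "poly (Phi b n) z \<noteq> 0"
      using nPhi[OF z, of n] Psi_nonzero[of b z n, OF b1] z by auto
    moreover have "w z > 0" using w1[of z] by simp
    ultimately show ?case by simp
  qed
  have Kint: "integrable circle_lebesgue (\<lambda>z. w z * (cmod (poly (Phi b n) z))\<^sup>2)" for n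
    by (rule circle.integrable_const_bound[where B = 2304]) (use Kb[of n] in auto)
  have K1: "K n \<le> 2304" for n
    unfolding K_def by (rule circle.integral_le_const[OF Kint]) (use Kb[of n] in auto)
  have K0: "0 < K n" for n
    using circle.integral_less_AE_space[of "\<lambda>_. 0" "\<lambda>z. w z * (cmod (poly (Phi b n) z))\<^sup>2"] Kint[of n] Kb[of n]
      circle.emeasure_space_1 by (auto simp: K_def)
  define \<phi> where "\<phi> = (\<lambda>n. smult (of_real (1 / sqrt (K n))) (Phi b n))"
  \<comment> \<open>The factor cancels the normalisation of \<open>\<phi> n\<close>, so that the
    summands are \<open>b n * poly (Phi b n) z\<close>.\<close>
  define \<alpha> where "\<alpha> = (\<lambda>n. b n * of_real (sqrt (K n)))"
  have "orthonormal_polys \<sigma> \<phi>"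
    unfolding orthonormal_polys_def
  proof (intro conjI allI)
    fix n
    have nz: "complex_of_real (1 / sqrt (K n)) \<noteq> 0" using K0[of n] by simp
    show deg: "degree (\<phi> n) = n" using nz by (simp add: \<phi>_def degree_Phi)
    have "lead_coeff (\<phi> n) = of_real (1 / sqrt (K n))"
      unfolding deg by (simp add: \<phi>_def coeff_Phi_top)
    then show "Im (lead_coeff (\<phi> n)) = 0" "Re (lead_coeff (\<phi> n)) > 0" using K0[of n] by simp_all
    fix k
    show "(\<integral>z. poly (\<phi> n) z * cnj (poly (\<phi> k) z) \<partial>\<sigma>) = (if n = k then 1 else 0)"
    proof (cases "n = k")
      case True
      have "w z *\<^sub>R (poly (\<phi> n) z * cnj (poly (\<phi> n) z)) = of_real (1 / K n * (w z * (cmod (poly (Phi b n) z))\<^sup>2))" for z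
      proof -
        have "poly (\<phi> n) z * cnj (poly (\<phi> n) z) = of_real ((cmod (poly (\<phi> n) z))\<^sup>2)"
          by (simp only: complex_norm_square)
        also have "(cmod (poly (\<phi> n) z))\<^sup>2 = 1 / K n * (cmod (poly (Phi b n) z))\<^sup>2"
          using K0[of n] by (simp add: \<phi>_def norm_mult norm_divide power_mult_distrib power_divide)
        finally show ?thesis by (simp add: scaleR_conv_of_real)
      qed
      then have "(\<integral>z. poly (\<phi> n) z * cnj (poly (\<phi> n) z) \<partial>\<sigma>) = of_real (1 / K n * K n)"
        unfolding K_def by (subst int_\<sigma>) (simp_all only: integral_complex_of_real integral_mult_right_zero, simp)
      then show ?thesis using True K0[of n] by simp
    next
      case False
      define a where "a = of_real (1 / c) * complex_of_real (1 / sqrt (K n)) * of_real (1 / sqrt (K k))"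
      have "w z *\<^sub>R (poly (\<phi> n) z * cnj (poly (\<phi> k) z)) = a * (w0 z *\<^sub>R (poly (Phi b n) z * cnj (poly (Phi b k) z)))" for z
        by (simp add: \<phi>_def w_def a_def scaleR_conv_of_real)
      then have "(\<integral>z. poly (\<phi> n) z * cnj (poly (\<phi> k) z) \<partial>\<sigma>) = a * 0"
        by (subst int_\<sigma>) (simp_all only: integral_mult_right_zero orth[OF False], simp)
      then show ?thesis using False by simp
    qed
  qed
  moreover have "summable (\<lambda>n. (cmod (\<alpha> n))\<^sup>2)"
  proof (rule summable_comparison_test'[OF summable_mult[OF sb, of 2304], of 0])
    fix n
    have "(cmod (\<alpha> n))\<^sup>2 = K n * (cmod (b n))\<^sup>2"
      using K0[of n] by (simp add: \<alpha>_def norm_mult power_mult_distrib)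
    also have "\<dots> \<le> 2304 * (cmod (b n))\<^sup>2" using K1[of n] by (intro mult_right_mono) auto
    finally show "norm ((cmod (\<alpha> n))\<^sup>2) \<le> 2304 * (cmod (b n))\<^sup>2" by simp
  qed
  moreover have "\<not> convergent (\<lambda>N. \<Sum>n<N. \<alpha> n * poly (\<phi> n) z)" if "z \<in> circleT" for z
  proof
    have z: "cmod z = 1" using that by (simp add: circleT_def)
    have summand: "\<alpha> n * poly (\<phi> n) z = b n * poly (Phi b n) z" for n
      using K0[of n] by (simp add: \<alpha>_def \<phi>_def)
    \<comment> \<open>The recursion for \<open>Psi\<close> telescopes, so convergence of the series
      at \<open>z\<close> would entail convergence of \<open>Psi b N\<close> there.\<close>
    have Psi: "poly (Psi b N) z = 1 + z * (\<Sum>n<N. \<alpha> n * poly (\<phi> n) z)" for N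
      by (induction N) (simp_all add: Psi_Suc summand algebra_simps)
    assume "convergent (\<lambda>N. \<Sum>n<N. \<alpha> n * poly (\<phi> n) z)"
    then have "convergent (\<lambda>N. poly (Psi b N) z)"
      unfolding Psi by (intro convergent_add convergent_mult convergent_const)
    then show False using div[OF z] by blast
  qed
  moreover have "infinite (measure_support \<sigma>)"
    unfolding \<sigma>_def by (rule infinite_measure_support_density[where c = "1/16"]) (use w1 in auto)
  moreover have "szego_class \<sigma>"
    unfolding \<sigma>_def by (rule szego_class_density[where c = "1/16" and C = 16]) (use w1 w2 in auto)
  ultimately show ?thesis using prob by blast
qed

end
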